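(* There is a universal constant $C$ such that for every convex polygon $P \subseteq \mathbb{R}^2$ whose convex grid piece $G_P$ is connected, $$\mathrm{rt}(P) \leq C\,(w(P) + h(P)).$$
   Context: A polygon $P\subseteq\mathbb{R}^2$ is regarded together with its interior. The convex grid piece $G_P$ cut out by a convex polygon $P$ is the graph whose vertices are all points of $\mathbb{Z}\times\mathbb{Z}$ lying in the interior or on the boundary of $P$, with an edge between each pair of vertices at Euclidean distance $1$. The width $w(P)$ and height $h(P)$ are the maximum absolute differences in $x$-coordinates and in $y$-coordinates, respectively, of any pair of points of the polygon $P$ (real numbers). Routing number: for a finite connected graph $G$ on $n$ vertices, place tokens labeled $1,\dots,n$ on the vertices, one per vertex. A routing step selects a set of pairwise disjoint edges of $G$ and, for each selected edge, swaps the two tokens at its endpoints. The routing number $\mathrm{rt}(G)$ is the maximum, over all pairs of token configurations, of the minimum number of routing steps needed to get from one to the other. Write $\mathrm{rt}(P)$ for $\mathrm{rt}(G_P)$. *)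

theory Defs
  imports "HOL-Analysis.Analysis"
begin

section \<open>Routing number of a finite graph\<close>

text \<open>
  A graph is given by its vertex set \<open>V\<close> and its set \<open>E\<close> of edges, an edge being the
  two-element set of its endpoints.
\<close>

definition graph_connected :: "'a set \<Rightarrow> 'a set set \<Rightarrow> bool" where
  "graph_connected V E \<longleftrightarrow> (\<forall>u\<in>V. \<forall>v\<in>V. (\<lambda>a b. {a, b} \<in> E)\<^sup>*\<^sup>* u v)"

text \<open>
  A configuration maps each vertex to the label of the token on it. It is fixed to be
  \<open>undefined\<close> off \<open>V\<close>, so that two configurations are equal iff they agree on \<open>V\<close>.
\<close>

definition token_configs :: "'a set \<Rightarrow> ('a \<Rightarrow> nat) set" where
  "token_configs V = {c \<in> extensional V. bij_betw c V {1..card V}}"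

definition routing_step :: "'a set set \<Rightarrow> ('a \<Rightarrow> nat) \<Rightarrow> ('a \<Rightarrow> nat) \<Rightarrow> bool" where
  "routing_step E c c' \<longleftrightarrow>
     (\<exists>M \<subseteq> E. pairwise disjnt M \<and>
        (\<forall>u v. {u, v} \<in> M \<longrightarrow> c' u = c v \<and> c' v = c u) \<and>
        (\<forall>v. v \<notin> \<Union>M \<longrightarrow> c' v = c v))"

definition routing_distance :: "'a set set \<Rightarrow> ('a \<Rightarrow> nat) \<Rightarrow> ('a \<Rightarrow> nat) \<Rightarrow> nat" where
  "routing_distance E c c' = (LEAST k. (routing_step E ^^ k) c c')"

text \<open>
  Only meaningful for a finite connected graph: then any configuration can be reached from any
  other, and the maximum is over a finite nonempty set.
\<close>

definition routing_number :: "'a set \<Rightarrow> 'a set set \<Rightarrow> nat" where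
  "routing_number V E =
     Max {routing_distance E c c' | c c'. c \<in> token_configs V \<and> c' \<in> token_configs V}"


section \<open>Convex grid pieces\<close>

text \<open>
  The plane is \<^typ>\<open>real \<times> real\<close>, whose \<^const>\<open>dist\<close> is Euclidean. A polygon includes its
  interior; segments and points are excluded as degenerate.
\<close>

definition convex_polygon :: "(real \<times> real) set \<Rightarrow> bool" where
  "convex_polygon P \<longleftrightarrow> polytope P \<and> interior P \<noteq> {}"

definition grid_vertices :: "(real \<times> real) set \<Rightarrow> (real \<times> real) set" where
  "grid_vertices P = (\<int> \<times> \<int>) \<inter> P"

definition grid_edges :: "(real \<times> real) set \<Rightarrow> (real \<times> real) set set" where
  "grid_edges P = {{u, v} | u v. u \<in> grid_vertices P \<and> v \<in> grid_vertices P \<and> dist u v = 1}"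

text \<open>The suprema are attained, since a polygon is compact and nonempty.\<close>

definition width :: "(real \<times> real) set \<Rightarrow> real" where
  "width P = Sup {\<bar>fst p - fst q\<bar> | p q. p \<in> P \<and> q \<in> P}"

definition height :: "(real \<times> real) set \<Rightarrow> real" where
  "height P = Sup {\<bar>snd p - snd q\<bar> | p q. p \<in> P \<and> q \<in> P}"

definition rt :: "(real \<times> real) set \<Rightarrow> nat" where
  "rt P = routing_number (grid_vertices P) (grid_edges P)"

end

theory Submission
  imports Defs "HOL-Combinatorics.Permutations"
begin

text \<open>
  Let \<open>n\<close> be the larger one of the two extents of the set of grid vertices, say the horizontal one.
  The idea is to find inside the piece a full rectangle of rows and columns whose numbers are comparable
  with the extents of the piece, to route this rectangle in \<open>O(n)\<close> steps by the classical
  column-row-column scheme, and to let all other vertices be served by it.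

  \<^emph>\<open>The rectangle.\<close> The segment from a leftmost to a rightmost vertex lies in \<open>P\<close> and has slope at
  most \<open>1\<close> in absolute value. In every column \<open>i\<close> some vertex \<open>(i, c i)\<close> lies at distance less than
  \<open>1\<close> from it. Heights are measured relative to this spine. After this shear, \<open>P\<close> is still convex up to
  bounded rounding errors and contains its horizontal axis, so it consists of a concave mountain above
  the axis and one below. By concavity each mountain has, over the middle half of the columns,
  up to rounding, at least a constant fraction of its maximal height (\<open>mountain_arm\<close>). Thus the middle columns and a
  constant fraction of the sheared rows span a full rectangle.

  \<^emph>\<open>Rows and columns.\<close> Columns are paths of the grid, and a path with \<open>N\<close> vertices is routed in
  \<open>2 N\<close> rounds by odd-even transposition sort (\<open>routable_path\<close>). Neighbours in a sheared row need not
  be adjacent, but since consecutive columns of a connected piece meet in a common lattice row, they are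
  joined by a walk of at most three edges, and the walks can be scheduled so that one round along
  sheared rows costs a constant number of rounds of the grid (\<open>sheared_realizable\<close>). The
  column-row-column scheme needs a proper edge colouring of a regular bipartite multigraph,
  which Hall's theorem provides (\<open>routable_rectangle\<close>).

  \<^emph>\<open>The remaining vertices.\<close> Suppose that \<open>A\<close> can be routed and that \<open>S\<close> is injected into \<open>A\<close> along
  columns. Then \<open>A \<union> S\<close> can be routed: bring the tokens that must enter \<open>S\<close> next to the tokens that
  must leave it, exchange them along the columns, and route \<open>S\<close> by carrying it over to its copy
  inside \<open>A\<close> (\<open>routable_extend\<close>). Each application may double the routed part of every column, so
  constantly many applications along rows and then along columns extend the
  rectangle to the whole piece (\<open>routable_fill\<close>), each at the price of a constant factor.
\<close>

section \<open>Permutations realized by rounds of disjoint swaps\<close>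

text \<open>
  A round is modelled as a permutation of the vertices. An involution moving every vertex along an
  edge or not at all is the same as a matching: its edges \<open>{v, q v}\<close> are automatically disjoint.
\<close>

definition swap_round :: "'a set set \<Rightarrow> ('a \<Rightarrow> 'a) \<Rightarrow> bool" where
  "swap_round E q \<longleftrightarrow> q \<circ> q = id \<and> (\<forall>v. q v \<noteq> v \<longrightarrow> {v, q v} \<in> E)"

text \<open>
  Products of exactly \<open>k\<close> rounds; as the identity is a round, \<open>k\<close> acts as an upper bound. If \<open>c\<close> is
  a configuration, then the outermost factor is performed first: \<open>c \<circ> (q \<circ> p') = (c \<circ> q) \<circ> p'\<close>.
\<close>

primrec realizable :: "'a set set \<Rightarrow> nat \<Rightarrow> ('a \<Rightarrow> 'a) \<Rightarrow> bool" where
  "realizable E 0 p \<longleftrightarrow> p = id"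
| "realizable E (Suc k) p \<longleftrightarrow> (\<exists>q p'. swap_round E q \<and> realizable E k p' \<and> p = q \<circ> p')"

text \<open>
  The typical case: \<open>f\<close> is the column or the row of a vertex, and all columns (rows) are permuted at
  the same time.
\<close>

definition fibre_routable :: "'a set set \<Rightarrow> 'a set \<Rightarrow> ('a \<Rightarrow> 'b) \<Rightarrow> nat \<Rightarrow> bool" where
  "fibre_routable E A f k \<longleftrightarrow>
     (\<forall>p. p permutes A \<longrightarrow> (\<forall>v. f (p v) = f v) \<longrightarrow> realizable E k p)"

definition routable :: "'a set set \<Rightarrow> 'a set \<Rightarrow> nat \<Rightarrow> bool" where
  "routable E A k \<longleftrightarrow> (\<forall>p. p permutes A \<longrightarrow> realizable E k p)"

lemma bij_supported_permutes: "bij p \<Longrightarrow> (\<And>v. v \<notin> A \<Longrightarrow> p v = v) \<Longrightarrow> p permutes A"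
  by (rule permutes_superset[OF bij_imp_permutes[of p UNIV]]) auto

lemma inverse_supported_permutes:
  assumes "\<And>v. g (p v) = v" "\<And>v. p (g v) = v" "\<And>v. v \<notin> A \<Longrightarrow> p v = v"
  shows "p permutes A"
  by (rule bij_supported_permutes[OF o_bij[of g p]]) (use assms in \<open>simp_all add: fun_eq_iff\<close>)

lemma swap_round_id: "swap_round E id"
  by (simp add: swap_round_def)

lemma swap_round_transpose: "u = v \<or> {u, v} \<in> E \<Longrightarrow> swap_round E (Transposition.transpose u v)"
  by (auto simp: swap_round_def Transposition.transpose_def insert_commute)

lemma realizable_SucI: "swap_round E q \<Longrightarrow> realizable E k p \<Longrightarrow> realizable E (Suc k) (q \<circ> p)"
  by auto

lemma realizable_id: "realizable E k id"
proof (induction k)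
  case (Suc k)
  show ?case using realizable_SucI[OF swap_round_id Suc] unfolding comp_id .
qed (simp only: realizable.simps)

lemma realizable_comp:
  assumes "realizable E k p" "realizable E l q"
  shows "realizable E (k + l) (p \<circ> q)"
  using assms(1)
proof (induction k arbitrary: p)
  case (Suc k)
  then obtain r p' where "swap_round E r" "realizable E k p'" "p = r \<circ> p'" by auto
  then show ?case using realizable_SucI[OF _ Suc.IH[of p']] by (simp only: comp_assoc add_Suc)
qed (use assms(2) in simp)

lemma realizable_mono:
  assumes "realizable E k p" "k \<le> l"
  shows "realizable E l p"
  using realizable_comp[OF assms(1) realizable_id[of E "l - k"]] assms(2) by simp

lemma realizable_swap_round: "swap_round E q \<Longrightarrow> realizable E 1 q"
  by auto

lemma swap_round_bij: "swap_round E q \<Longrightarrow> bij q"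
  unfolding swap_round_def using o_bij by blast

lemma realizable_inv:
  assumes "realizable E k p"
  shows "bij p \<and> realizable E k (inv p)"
  using assms
proof (induction k arbitrary: p)
  case 0
  then have "p = id" by simp
  show ?case unfolding \<open>p = id\<close> inv_id using bij_id realizable_id by blast
next
  case (Suc k)
  then obtain r p' where r: "swap_round E r" and p': "realizable E k p'" and p: "p = r \<circ> p'" by auto
  have bij: "bij p'" "realizable E k (inv p')" using Suc.IH[OF p'] by auto
  have "inv r = r" using r by (simp add: swap_round_def inv_unique_comp)
  then have "inv p = inv p' \<circ> r"
    using o_inv_distrib[OF swap_round_bij[OF r] bij(1)] p by simp
  then have "realizable E (k + 1) (inv p)"
    using realizable_comp[OF bij(2) realizable_swap_round[OF r]] by simp
  moreover have "bij p" unfolding p by (rule bij_comp[OF bij(1) swap_round_bij[OF r]])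
  ultimately show ?case unfolding Suc_eq_plus1 by (rule conjI[rotated])
qed

text \<open>
  The locality that makes parallel execution possible.
\<close>

lemma realizable_within:
  assumes "realizable {e \<in> E. e \<subseteq> A} k p"
  shows "v \<in> A \<longleftrightarrow> p v \<in> A" "v \<notin> A \<Longrightarrow> p v = v"
proof -
  have "(v \<in> A \<longleftrightarrow> p v \<in> A) \<and> (v \<notin> A \<longrightarrow> p v = v)" for v
    using assms
  proof (induction k arbitrary: p)
    case (Suc k)
    then obtain r p' where r: "swap_round {e \<in> E. e \<subseteq> A} r"
      and p': "realizable {e \<in> E. e \<subseteq> A} k p'" and p: "p = r \<circ> p'" by auto
    have "(w \<in> A \<longleftrightarrow> r w \<in> A) \<and> (w \<notin> A \<longrightarrow> r w = w)" for w
      using r unfolding swap_round_def by (cases "r w = w") auto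
    then show ?case using Suc.IH[OF p'] unfolding p comp_apply by metis
  qed simp
  then show "v \<in> A \<longleftrightarrow> p v \<in> A" "v \<notin> A \<Longrightarrow> p v = v" by auto
qed

text \<open>
  Permutations of disjoint parts of the graph are performed simultaneously, at the cost of the slowest
  one: the \<open>t\<close>-th rounds of all parts combine to one round. The parts are the fibres of \<open>idx\<close>.
\<close>

lemma realizable_parallel:
  fixes idx :: "'a \<Rightarrow> 'i"
  assumes "\<And>i. realizable {e \<in> E. e \<subseteq> {v. idx v = i}} k (p i)"
  shows "realizable E k (\<lambda>v. p (idx v) v)"
  using assms
proof (induction k arbitrary: p)
  case 0
  then have p: "p i = id" for i by (simp only: realizable.simps)
  show ?case unfolding p realizable.simps by (simp only: fun_eq_iff id_apply simp_thms)
next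
  case (Suc k)
  let ?E = "\<lambda>i. {e \<in> E. e \<subseteq> {v. idx v = i}}"
  have "\<forall>i. \<exists>r p'. swap_round (?E i) r \<and> realizable (?E i) k p' \<and> p i = r \<circ> p'"
    using Suc.prems by simp
  from choice[OF this] obtain r
    where "\<forall>i. \<exists>p'. swap_round (?E i) (r i) \<and> realizable (?E i) k p' \<and> p i = r i \<circ> p'" ..
  from choice[OF this] obtain p'
    where "\<forall>i. swap_round (?E i) (r i) \<and> realizable (?E i) k (p' i) \<and> p i = r i \<circ> p' i" ..
  then have r: "\<And>i. swap_round (?E i) (r i)" and p': "\<And>i. realizable (?E i) k (p' i)"
    and p: "\<And>i. p i = r i \<circ> p' i" by simp_all
  have idx_p': "idx (p' (idx v) v) = idx v" for v
    using realizable_within(1)[OF p', of v "idx v"] by simp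
  have idx_r: "idx (r (idx v) v) = idx v" for v
    using realizable_within(1)[OF realizable_swap_round[OF r], of v "idx v"] by simp
  have rr: "r i (r i w) = w" for i w
    using r[of i] unfolding swap_round_def by (metis comp_apply id_apply)
  have round: "swap_round E (\<lambda>v. r (idx v) v)"
    unfolding swap_round_def
  proof (intro conjI allI impI)
    show "(\<lambda>v. r (idx v) v) \<circ> (\<lambda>v. r (idx v) v) = id"
      by (simp add: fun_eq_iff idx_r rr)
    show "{v, r (idx v) v} \<in> E" if "r (idx v) v \<noteq> v" for v
      using r[of "idx v"] that unfolding swap_round_def by blast
  qed
  have split: "(\<lambda>v. p (idx v) v) = (\<lambda>v. r (idx v) v) \<circ> (\<lambda>v. p' (idx v) v)"
    by (simp only: fun_eq_iff comp_apply p idx_p' simp_thms)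
  have rest: "realizable E k (\<lambda>v. p' (idx v) v)" by (rule Suc.IH) (rule p')
  show ?case unfolding split by (rule realizable_SucI[OF round rest])
qed

lemma realizable_transport:
  assumes real: "realizable E k p" and inj: "inj_on e A"
    and EA: "\<And>X. X \<in> E \<Longrightarrow> X \<subseteq> A" and EF: "\<And>X. X \<in> E \<Longrightarrow> e ` X \<in> F"
  shows "realizable F k (\<lambda>v. if v \<in> e ` A then e (p (inv_into A e v)) else v)"
  using real
proof (induction k arbitrary: p)
  case 0
  then have p: "p v = v" for v by simp
  have "(if v \<in> e ` A then e (p (inv_into A e v)) else v) = v" for v
    using f_inv_into_f[of v e A] by (cases "v \<in> e ` A") (simp_all add: p)
  then have "(\<lambda>v. if v \<in> e ` A then e (p (inv_into A e v)) else v) = id" by (simp only: fun_eq_iff id_apply simp_thms)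
  then show ?case by (simp only: realizable.simps)
next
  case (Suc k)
  then obtain r p' where r: "swap_round E r" and p': "realizable E k p'" and p: "p = r \<circ> p'" by auto
  let ?T = "\<lambda>q v. if v \<in> e ` A then e (q (inv_into A e v)) else v"
  have E0: "realizable E l q \<longleftrightarrow> realizable {X \<in> E. X \<subseteq> A} l q" for l q
    using EA by (metis (mono_tags, lifting) Collect_cong Collect_mem_eq)
  have local: "q v \<in> A" if "realizable E l q" "v \<in> A" for l q v
    using realizable_within(1)[OF iffD1[OF E0 that(1)], of v] that(2) by simp
  have rA: "r v \<in> A" if "v \<in> A" for v
    by (rule local[OF realizable_swap_round[OF r] that])
  have p'A: "p' v \<in> A" if "v \<in> A" for v
    by (rule local[OF p' that])
  have inv: "inv_into A e (e v) = v" if "v \<in> A" for v using inj that by simp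
  have round: "swap_round F (?T r)"
    unfolding swap_round_def
  proof (intro conjI allI impI)
    show "?T r \<circ> ?T r = id"
    proof
      fix v show "(?T r \<circ> ?T r) v = id v"
      proof (cases "v \<in> e ` A")
        case True
        then obtain a where a: "a \<in> A" "v = e a" by auto
        moreover have "r (r a) = a" using r by (simp add: swap_round_def fun_eq_iff)
        ultimately show ?thesis using rA[OF a(1)] inv by simp
      qed simp
    qed
    fix v assume v: "?T r v \<noteq> v"
    then have "v \<in> e ` A" by (auto split: if_splits)
    then obtain a where a: "a \<in> A" "v = e a" by auto
    then have "r a \<noteq> a" using v inv by auto
    then have "{a, r a} \<in> E" using r by (simp add: swap_round_def)
    then show "{v, ?T r v} \<in> F" using EF[of "{a, r a}"] a inv by simp
  qed
  have split: "?T p = ?T r \<circ> ?T p'"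
  proof
    fix v show "?T p v = (?T r \<circ> ?T p') v"
    proof (cases "v \<in> e ` A")
      case True
      then obtain a where "a \<in> A" "v = e a" by auto
      then show ?thesis using p'A[of a] inv p by simp
    qed simp
  qed
  show ?case using realizable_SucI[OF round Suc.IH[OF p']] by (simp only: split)
qed

lemma routable_transport:
  assumes rout: "routable E A k" and inj: "inj_on e A"
    and EA: "\<And>X. X \<in> E \<Longrightarrow> X \<subseteq> A" and EF: "\<And>X. X \<in> E \<Longrightarrow> e ` X \<in> F"
  shows "routable F (e ` A) k"
  unfolding routable_def
proof (intro allI impI)
  fix p assume p: "p permutes e ` A"
  have bij: "bij_betw (inv_into A e) (e ` A) A" using inj by (simp add: inj_on_imp_bij_betw bij_betw_inv_into)
  define q where "q = map_permutation (e ` A) (inv_into A e) p"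
  have qA: "q permutes A" unfolding q_def
    using map_permutation_permutes[OF bij p] by simp
  have q: "q a = inv_into A e (p (e a))" if "a \<in> A" for a
    using map_permutation_apply[of "inv_into A e" "e ` A" "e a" p] that inj bij
    unfolding q_def by (simp add: bij_betw_def)
  have "realizable F k (\<lambda>v. if v \<in> e ` A then e (q (inv_into A e v)) else v)"
    using realizable_transport[OF _ inj EA EF] rout qA unfolding routable_def by blast
  moreover have "(\<lambda>v. if v \<in> e ` A then e (q (inv_into A e v)) else v) = p"
  proof
    fix v show "(if v \<in> e ` A then e (q (inv_into A e v)) else v) = p v"
    proof (cases "v \<in> e ` A")
      case True
      then obtain a where a: "a \<in> A" "v = e a" by auto
      then have "p v \<in> e ` A" using permutes_in_image[OF p] by simp
      then have "e (q a) = p v" using q[OF a(1)] a f_inv_into_f[of "p v" e A] by simp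
      then show ?thesis using a inj by simp
    qed (use p in \<open>simp add: permutes_not_in\<close>)
  qed
  ultimately show "realizable F k p" by simp
qed

lemma swap_round_routing_step:
  assumes "swap_round E q"
  shows "routing_step E c (c \<circ> q)"
proof -
  have qq: "q (q v) = v" for v using assms by (simp add: swap_round_def fun_eq_iff)
  let ?M = "{{v, q v} | v. q v \<noteq> v}"
  have "?M \<subseteq> E" using assms by (auto simp: swap_round_def)
  moreover have "pairwise disjnt ?M"
  proof (intro pairwiseI)
    fix X Y assume "X \<in> ?M" "Y \<in> ?M" "X \<noteq> Y"
    then obtain u v where X: "X = {u, q u}" and Y: "Y = {v, q v}" by blast
    show "disjnt X Y"
    proof (rule ccontr)
      assume "\<not> disjnt X Y"
      then have "u = v \<or> u = q v \<or> q u = v \<or> q u = q v" using X Y by (auto simp: disjnt_def)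
      then have "u = v \<or> u = q v" using qq by metis
      then show False using \<open>X \<noteq> Y\<close> X Y qq by (auto simp: insert_commute)
    qed
  qed
  moreover have "(c \<circ> q) u = c v \<and> (c \<circ> q) v = c u" if "{u, v} \<in> ?M" for u v
    using that qq by (auto simp: doubleton_eq_iff)
  moreover have "(c \<circ> q) v = c v" if "v \<notin> \<Union>?M" for v
  proof (cases "q v = v")
    case False
    then have "v \<in> \<Union>?M" by blast
    then show ?thesis using that by simp
  qed simp
  ultimately show ?thesis unfolding routing_step_def by blast
qed

text \<open>
  The link to token configurations: a permutation \<open>p\<close> of the vertices acts on configurations by
  precomposition.
\<close>

lemma realizable_routing_steps:
  "realizable E k p \<Longrightarrow> (routing_step E ^^ k) c (c \<circ> p)"
proof (induction k arbitrary: c p)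
  case (Suc k)
  then obtain r p' where r: "swap_round E r" and p': "realizable E k p'" and p: "p = r \<circ> p'" by auto
  have rest: "(routing_step E ^^ k) (c \<circ> r) (c \<circ> p)"
    using Suc.IH[OF p', of "c \<circ> r"] p by (simp only: comp_assoc)
  show ?case by (rule relpowp_Suc_I2[where y = "c \<circ> r", OF swap_round_routing_step[OF r] rest])
qed simp

lemma token_configs_permute:
  assumes "finite V" "c \<in> token_configs V" "c' \<in> token_configs V"
  shows "\<exists>p. p permutes V \<and> c' = c \<circ> p"
proof -
  have bij: "bij_betw c V {1..card V}" "bij_betw c' V {1..card V}"
    and ext: "c \<in> extensional V" "c' \<in> extensional V"
    using assms unfolding token_configs_def by auto
  let ?p = "\<lambda>v. if v \<in> V then inv_into V c (c' v) else v"
  have "bij_betw (inv_into V c \<circ> c') V V"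
    using bij_betw_trans[OF bij(2) bij_betw_inv_into[OF bij(1)]] .
  then have "bij_betw ?p V V" by (rule bij_betw_cong[THEN iffD1, rotated]) simp
  then have "?p permutes V" by (rule bij_imp_permutes) simp
  moreover have "c' v = c (?p v)" for v
  proof (cases "v \<in> V")
    case True
    then have "c' v \<in> c ` V" using bij by (auto simp: bij_betw_def)
    then show ?thesis using True by (simp add: f_inv_into_f)
  qed (use ext in \<open>simp add: extensional_def\<close>)
  ultimately show ?thesis by (auto simp: fun_eq_iff)
qed

lemma routing_number_le:
  assumes fin: "finite V" and rout: "routable E V k"
  shows "routing_number V E \<le> k"
proof -
  let ?S = "{routing_distance E c c' | c c'. c \<in> token_configs V \<and> c' \<in> token_configs V}"
  have le: "routing_distance E c c' \<le> k" if c: "c \<in> token_configs V" "c' \<in> token_configs V" for c c'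
  proof -
    obtain p where "p permutes V" "c' = c \<circ> p" using token_configs_permute[OF fin c] by blast
    then have "(routing_step E ^^ k) c c'"
      using rout realizable_routing_steps unfolding routable_def by blast
    then show ?thesis unfolding routing_distance_def by (rule Least_le)
  qed
  obtain h where h: "bij_betw h V {1..card V}" using fin finite_same_card_bij[of V "{1..card V}"] by auto
  have "restrict h V \<in> token_configs V"
    unfolding token_configs_def using h by (simp add: bij_betw_restrict_eq)
  then have "?S \<noteq> {}" by blast
  moreover have "finite ?S" by (rule finite_subset[of _ "{..k}"]) (use le in auto)
  ultimately show ?thesis unfolding routing_number_def using le by (subst Max_le_iff) auto
qed

section \<open>Routing on paths by odd-even transposition\<close>

text \<open>
  In round \<open>t\<close>, position \<open>i\<close> is the right end of a comparison if \<open>t + i\<close> is odd, and the left end otherwise.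
\<close>

definition odd_even_round :: "nat \<Rightarrow> nat \<Rightarrow> (nat \<Rightarrow> nat) \<Rightarrow> nat \<Rightarrow> nat" where
  "odd_even_round N t a i =
     (if 0 < i \<and> i < N \<and> odd (t + i) \<and> a i < a (i - 1) then i - 1
      else if Suc i < N \<and> even (t + i) \<and> a (Suc i) < a i then Suc i else i)"

primrec odd_even_sort :: "nat \<Rightarrow> (nat \<Rightarrow> nat) \<Rightarrow> nat \<Rightarrow> nat \<Rightarrow> nat" where
  "odd_even_sort N p 0 = p"
| "odd_even_sort N p (Suc t) = odd_even_sort N p t \<circ> odd_even_round N t (odd_even_sort N p t)"

definition path_edges :: "nat \<Rightarrow> nat set set" where
  "path_edges N = {{i, Suc i} | i. Suc i < N}"

lemma odd_even_round_invol: "odd_even_round N t a (odd_even_round N t a i) = i"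
  unfolding odd_even_round_def by auto

lemma swap_round_odd_even: "swap_round (path_edges N) (odd_even_round N t a)"
  unfolding swap_round_def
proof (intro conjI allI impI)
  show "odd_even_round N t a \<circ> odd_even_round N t a = id"
    by (rule ext) (simp add: odd_even_round_invol)
  fix i assume "odd_even_round N t a i \<noteq> i"
  then consider "0 < i" "i < N" "odd_even_round N t a i = i - 1"
    | "Suc i < N" "odd_even_round N t a i = Suc i"
    unfolding odd_even_round_def by (auto split: if_splits)
  then show "{i, odd_even_round N t a i} \<in> path_edges N"
  proof cases
    case 1
    then obtain k where "i = Suc k" "odd_even_round N t a i = k" by (cases i) auto
    then show ?thesis unfolding path_edges_def using 1 by (auto simp: doubleton_eq_iff)
  qed (auto simp: path_edges_def)
qed

lemma odd_even_sort_realizable: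
  "\<exists>r. realizable (path_edges N) t r \<and> odd_even_sort N p t = p \<circ> r"
proof (induction t)
  case 0
  show ?case using realizable_id[of "path_edges N" 0]
    by (intro exI[of _ id]) (simp only: odd_even_sort.simps comp_id simp_thms)
next
  case (Suc t)
  then obtain r where r: "realizable (path_edges N) t r" "odd_even_sort N p t = p \<circ> r" by blast
  let ?q = "odd_even_round N t (odd_even_sort N p t)"
  have "realizable (path_edges N) (t + 1) (r \<circ> ?q)"
    by (rule realizable_comp[OF r(1) realizable_swap_round[OF swap_round_odd_even]])
  moreover have "odd_even_sort N p (Suc t) = p \<circ> (r \<circ> ?q)"
    using r(2) by (simp add: comp_assoc)
  ultimately show ?case by (metis Suc_eq_plus1)
qed

text \<open>
  The correctness proof follows the 0-1 principle: for each threshold \<open>\<theta>\<close> it only looks at which entries are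
  at least \<open>\<theta>\<close>, through the number of such entries at positions \<open>j\<close> and beyond.
\<close>

definition large_right :: "nat \<Rightarrow> nat \<Rightarrow> (nat \<Rightarrow> nat) \<Rightarrow> nat \<Rightarrow> nat" where
  "large_right N \<theta> a j = card {i. j \<le> i \<and> i < N \<and> \<theta> \<le> a i}"

text \<open>
  If no comparison is made across the boundary between \<open>j - 1\<close> and \<open>j\<close>, then the round permutes the
  positions from \<open>j\<close> on.
\<close>

lemma large_right_idle:
  assumes "j = 0 \<or> even (t + j)"
  shows "large_right N \<theta> a j \<le> large_right N \<theta> (a \<circ> odd_even_round N t a) j"
  unfolding large_right_def
proof (rule card_inj_on_le[where f = "odd_even_round N t a"])
  show "inj_on (odd_even_round N t a) {i. j \<le> i \<and> i < N \<and> \<theta> \<le> a i}"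
    by (rule inj_on_inverseI[of _ "odd_even_round N t a"]) (rule odd_even_round_invol)
  have "j \<le> odd_even_round N t a i \<and> odd_even_round N t a i < N" if "j \<le> i" "i < N" for i
  proof (cases "i = j")
    case True
    then show ?thesis using assms that unfolding odd_even_round_def by auto
  next
    case False
    then show ?thesis using that unfolding odd_even_round_def by auto
  qed
  then show "odd_even_round N t a ` {i. j \<le> i \<and> i < N \<and> \<theta> \<le> a i}
      \<subseteq> {i. j \<le> i \<and> i < N \<and> \<theta> \<le> (a \<circ> odd_even_round N t a) i}"
    by (auto simp: odd_even_round_invol)
  show "finite {i. j \<le> i \<and> i < N \<and> \<theta> \<le> (a \<circ> odd_even_round N t a) i}"
    by (rule finite_subset[of _ "{..<N}"]) auto
qed

lemma large_right_step:
  assumes "j < N"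
  shows "large_right N \<theta> a j = large_right N \<theta> a (Suc j) + (if \<theta> \<le> a j then 1 else 0)"
proof -
  have "{i. j \<le> i \<and> i < N \<and> \<theta> \<le> a i}
      = (if \<theta> \<le> a j then {j} else {}) \<union> {i. Suc j \<le> i \<and> i < N \<and> \<theta> \<le> a i}"
    using assms by (auto simp: le_less Suc_le_eq)
  moreover have "finite {i. Suc j \<le> i \<and> i < N \<and> \<theta> \<le> a i}"
    by (rule finite_subset[of _ "{..<N}"]) auto
  ultimately show ?thesis unfolding large_right_def by simp
qed

text \<open>
  Comparing the positions \<open>j - 1\<close> and \<open>j\<close> places the larger entry at \<open>j\<close>. If that entry is large, it
  adds one to the large entries beyond \<open>j\<close>; otherwise neither of the two is large, and the counts from \<open>j - 1\<close>
  and from \<open>j + 1\<close> agree. So the counts evolve by a recursion in minima.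
\<close>

lemma large_right_compare:
  assumes j: "0 < j" "j < N" "odd (t + j)"
    and k: "k \<le> large_right N \<theta> a (j - 1)" "k \<le> Suc (large_right N \<theta> a (Suc j))"
  shows "k \<le> large_right N \<theta> (a \<circ> odd_even_round N t a) j"
proof -
  let ?b = "a \<circ> odd_even_round N t a"
  have idle: "large_right N \<theta> a (Suc j) \<le> large_right N \<theta> ?b (Suc j)"
    using j by (intro large_right_idle) simp
  have bj: "?b j = max (a (j - 1)) (a j)"
    using j unfolding odd_even_round_def by (auto simp: max_def)
  have "large_right N \<theta> ?b j = large_right N \<theta> ?b (Suc j) + (if \<theta> \<le> ?b j then 1 else 0)"
    by (rule large_right_step[OF j(2)])
  moreover have "large_right N \<theta> a (j - 1) = large_right N \<theta> a (Suc j)" if "\<not> \<theta> \<le> ?b j"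
  proof -
    have "\<not> \<theta> \<le> a j" "\<not> \<theta> \<le> a (j - 1)" using that unfolding bj by auto
    then show ?thesis
      using large_right_step[of "j - 1" N \<theta> a] large_right_step[of j N \<theta> a] j by simp
  qed
  ultimately show ?thesis using idle k by (cases "\<theta> \<le> ?b j") auto
qed

text \<open>
  Unfolding the recursion: the count from \<open>j\<close> on is limited only by the number of all large entries, by the
  number of positions, and by a front that moves one position per round and then lets one entry pass in every
  second round.
\<close>

lemma large_right_bound:
  assumes "k \<le> large_right N \<theta> p 0" "k \<le> N - j" "k \<le> (t - j) div 2"
  shows "k \<le> large_right N \<theta> (odd_even_sort N p t) j"
  using assms
proof (induction t arbitrary: j k)
  case (Suc t)
  let ?a = "odd_even_sort N p t"
  let ?L = "large_right N \<theta>"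
  have eq: "?L (odd_even_sort N p (Suc t)) j = ?L (?a \<circ> odd_even_round N t ?a) j" by simp
  consider "j = 0" | "N \<le> j" | "0 < j" "j < N" "odd (t + j)" | "0 < j" "j < N" "even (t + j)"
    by linarith
  then show ?case
  proof cases
    case 1
    have "?L p 0 \<le> ?L (odd_even_sort N p s) 0" for s
    proof (induction s)
      case (Suc s)
      then show ?case
        using large_right_idle[of 0 s N \<theta> "odd_even_sort N p s"]
        unfolding odd_even_sort.simps by linarith
    qed simp
    then show ?thesis using Suc.prems(1) le_trans unfolding 1 by blast
  next
    case 2
    then show ?thesis using Suc.prems(2) by simp
  next
    case 3
    have left: "k \<le> ?L ?a (j - 1)"
      by (rule Suc.IH) (use Suc.prems 3 in auto)
    have right: "k - 1 \<le> ?L ?a (Suc j)"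
    proof (rule Suc.IH)
      have "(Suc t - j) div 2 \<le> (t - Suc j + 2) div 2" by (rule div_le_mono) simp
      then show "k - 1 \<le> (t - Suc j) div 2" using Suc.prems(3) by simp
    qed (use Suc.prems 3 in linarith)+
    show ?thesis unfolding eq by (rule large_right_compare) (use 3 left right in auto)
  next
    case 4
    have "(Suc t - j) div 2 = (t - j) div 2"
    proof (cases "j \<le> t")
      case True
      then have "even (t - j)" using 4 by auto
      then show ?thesis using True by (simp add: Suc_diff_le)
    qed simp
    then have "k \<le> ?L ?a j" by (intro Suc.IH) (use Suc.prems in auto)
    also have "\<dots> \<le> ?L (odd_even_sort N p (Suc t)) j"
      unfolding eq by (rule large_right_idle) (use 4 in simp)
    finally show ?thesis .
  qed
qed simp

text \<open>
  After \<open>2 N\<close> rounds the front has passed. With \<open>\<theta> = j\<close> the bound says that all positions from \<open>j\<close> on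
  hold entries that are at least \<open>j\<close>; a permutation with this property for all \<open>j\<close> is the identity.
\<close>

lemma odd_even_sort_sorts:
  assumes p: "p permutes {..<N}"
  shows "odd_even_sort N p (2 * N) = id"
proof -
  let ?a = "odd_even_sort N p (2 * N)"
  obtain r where r: "realizable (path_edges N) (2 * N) r" "?a = p \<circ> r"
    using odd_even_sort_realizable by blast
  have "path_edges N = {e \<in> path_edges N. e \<subseteq> {..<N}}" unfolding path_edges_def by auto
  then have E: "realizable (path_edges N) k q \<longleftrightarrow> realizable {e \<in> path_edges N. e \<subseteq> {..<N}} k q" for k q
    by metis
  have "r permutes {..<N}"
    by (rule bij_supported_permutes)
      (use realizable_inv[OF r(1)] realizable_within(2)[OF iffD1[OF E r(1)]] in auto)
  then have a: "?a permutes {..<N}" unfolding r(2) by (rule permutes_compose[OF _ p])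
  have "j \<le> ?a j" if "j < N" for j
  proof -
    have "large_right N j p 0 = card {i \<in> {..<N}. p i \<in> {j..<N}}"
      unfolding large_right_def using permutes_in_image[OF p] by (intro arg_cong[where f = card]) auto
    also have "\<dots> = card (p -` {j..<N})"
      using permutes_not_in[OF p] by (intro arg_cong[where f = card]) fastforce
    also have "\<dots> = N - j"
      using card_vimage_inj[of p "{j..<N}"] permutes_inj[OF p] permutes_surj[OF p] by simp
    finally have "N - j \<le> large_right N j ?a j"
      by (intro large_right_bound) auto
    moreover have "card {j..<N} = N - j" by simp
    ultimately have "{i. j \<le> i \<and> i < N \<and> j \<le> ?a i} = {j..<N}"
      unfolding large_right_def by (intro card_seteq) auto
    moreover have "j \<in> {j..<N}" using that by simp
    ultimately show ?thesis by blast
  qed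
  then show ?thesis using permutes_natset_ge[OF a] by simp
qed

theorem routable_path: "routable (path_edges N) {..<N} (2 * N)"
  unfolding routable_def
proof (intro allI impI)
  fix p :: "nat \<Rightarrow> nat" assume p: "p permutes {..<N}"
  obtain r where r: "realizable (path_edges N) (2 * N) r" "odd_even_sort N p (2 * N) = p \<circ> r"
    using odd_even_sort_realizable by blast
  then have "p \<circ> r = id" using odd_even_sort_sorts[OF p] by simp
  then have "p = inv r" using realizable_inv[OF r(1)]
    by (metis bij_is_surj comp_assoc comp_id id_comp surj_iff)
  then show "realizable (path_edges N) (2 * N) p" using realizable_inv[OF r(1)] by simp
qed

text \<open>
  Each fibre is sorted along its own path, and the sorts run in parallel.
\<close>

lemma fibre_routable_paths:
  assumes "\<And>x. \<exists>e n. n \<le> N \<and> inj_on e {..<n} \<and> e ` {..<n} = {v \<in> A. f v = x}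
      \<and> (\<forall>i. Suc i < n \<longrightarrow> {e i, e (Suc i)} \<in> E)"
  shows "fibre_routable E A f (2 * N)"
  unfolding fibre_routable_def
proof (intro allI impI)
  fix p assume p: "p permutes A" and fp: "\<forall>v. f (p v) = f v"
  define q where "q = (\<lambda>x v. if f v = x then p v else v)"
  have "realizable {X \<in> E. X \<subseteq> {v. f v = x}} (2 * N) (q x)" for x
  proof -
    obtain e n where e: "n \<le> N" "inj_on e {..<n}" "e ` {..<n} = {v \<in> A. f v = x}"
      "\<And>i. Suc i < n \<Longrightarrow> {e i, e (Suc i)} \<in> E"
      using assms[of x] by blast
    have "routable {X \<in> E. X \<subseteq> {v. f v = x}} (e ` {..<n}) (2 * n)"
    proof (rule routable_transport[OF routable_path e(2)])
      fix X assume X: "X \<in> path_edges n"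
      then show "X \<subseteq> {..<n}" unfolding path_edges_def by auto
      then have "e ` X \<subseteq> {v. f v = x}" using e(3) by blast
      then show "e ` X \<in> {X \<in> E. X \<subseteq> {v. f v = x}}"
        using X e(4) unfolding path_edges_def by auto
    qed
    moreover have "q x permutes {v \<in> A. f v = x}"
    proof (rule inverse_supported_permutes[where g = "\<lambda>v. if f v = x then inv p v else v"])
      have f_inv: "f (inv p v) = f v" for v using fp by (metis p permutes_inverses(1))
      show "(if f (q x v) = x then inv p (q x v) else q x v) = v"
        "q x (if f v = x then inv p v else v) = v" for v
        unfolding q_def using fp f_inv permutes_inverses[OF p] by simp_all
      show "q x v = v" if "v \<notin> {v \<in> A. f v = x}" for v
        using that permutes_not_in[OF p] unfolding q_def by auto
    qed
    ultimately have "realizable {X \<in> E. X \<subseteq> {v. f v = x}} (2 * n) (q x)"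
      unfolding routable_def e(3) by blast
    then show ?thesis using e(1) by (auto intro: realizable_mono)
  qed
  then have "realizable E (2 * N) (\<lambda>v. q (f v) v)" by (rule realizable_parallel)
  then show "realizable E (2 * N) p" unfolding q_def by simp
qed

section \<open>Edge colouring of regular bipartite multigraphs\<close>

text \<open>
  Hall's theorem, by the argument of Halmos and Vaughan: either some nonempty proper subfamily is tight, and
  then it and its complement can be matched separately, or there is enough slack to match one element
  arbitrarily.
\<close>

theorem hall_marriage:
  fixes N :: "'a \<Rightarrow> 'b set"
  assumes "finite I" "\<And>i. i \<in> I \<Longrightarrow> finite (N i)"
    and "\<And>J. J \<subseteq> I \<Longrightarrow> card J \<le> card (\<Union>i\<in>J. N i)"
  shows "\<exists>h. inj_on h I \<and> (\<forall>i\<in>I. h i \<in> N i)"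
  using assms
proof (induction "card I" arbitrary: I N rule: less_induct)
  case less
  note hall = less.prems(3)
  show ?case
  proof (cases "\<exists>J. J \<subset> I \<and> J \<noteq> {} \<and> card (\<Union>i\<in>J. N i) = card J")
    case True
    then obtain J where J: "J \<subset> I" "J \<noteq> {}" "card (\<Union>i\<in>J. N i) = card J" by blast
    have finJ: "finite J" using J(1) less.prems(1) finite_subset by blast
    have finN: "finite (\<Union>i\<in>K. N i)" if "K \<subseteq> I" for K
      using that less.prems(1,2) finite_subset by blast
    have "\<exists>h. inj_on h J \<and> (\<forall>i\<in>J. h i \<in> N i)"
    proof (rule less.hyps)
      show "card J < card I" using J(1) less.prems(1) psubset_card_mono by blast
    qed (use J(1) less.prems finJ in auto)
    then obtain h1 where h1: "inj_on h1 J" "\<And>i. i \<in> J \<Longrightarrow> h1 i \<in> N i" by blast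
    let ?N' = "\<lambda>i. N i - (\<Union>j\<in>J. N j)"
    have "\<exists>h. inj_on h (I - J) \<and> (\<forall>i\<in>I - J. h i \<in> ?N' i)"
    proof (rule less.hyps)
      show "card (I - J) < card I"
        by (rule psubset_card_mono) (use J less.prems(1) in auto)
      fix K assume K: "K \<subseteq> I - J"
      have finK: "finite K" using K less.prems(1) finite_subset by blast
      have "card K + card J = card (K \<union> J)"
        using K finK finJ by (intro card_Un_disjoint[symmetric]) auto
      also have "\<dots> \<le> card (\<Union>i\<in>K \<union> J. N i)" by (rule hall) (use K J(1) in auto)
      also have "(\<Union>i\<in>K \<union> J. N i) = (\<Union>i\<in>K. ?N' i) \<union> (\<Union>j\<in>J. N j)" by blast
      also have "card \<dots> \<le> card (\<Union>i\<in>K. ?N' i) + card (\<Union>j\<in>J. N j)" by (rule card_Un_le)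
      finally show "card K \<le> card (\<Union>i\<in>K. ?N' i)" using J(3) by simp
    qed (use less.prems in auto)
    then obtain h2 where h2: "inj_on h2 (I - J)" "\<And>i. i \<in> I - J \<Longrightarrow> h2 i \<in> ?N' i" by blast
    let ?h = "\<lambda>i. if i \<in> J then h1 i else h2 i"
    have cross: "h1 i \<noteq> h2 k" if "i \<in> J" "k \<in> I - J" for i k
    proof -
      have "h1 i \<in> (\<Union>j\<in>J. N j)" using h1(2)[OF that(1)] that(1) by (rule UN_I[rotated])
      then show ?thesis using h2(2)[OF that(2)] by auto
    qed
    have "inj_on ?h I"
    proof (rule inj_onI)
      fix i k assume ik: "i \<in> I" "k \<in> I" "?h i = ?h k"
      show "i = k"
        by (cases "i \<in> J"; cases "k \<in> J")
          (use ik cross[of i k] cross[of k i] inj_onD[OF h1(1)] inj_onD[OF h2(1)] in auto)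
    qed
    moreover have "?h i \<in> N i" if "i \<in> I" for i using h1(2) h2(2) that by auto
    ultimately show ?thesis by blast
  next
    case False
    show ?thesis
    proof (cases "I = {}")
      case False
      then obtain i where i: "i \<in> I" by blast
      then have "card {i} \<le> card (N i)" using hall[of "{i}"] by simp
      then obtain x where x: "x \<in> N i" by fastforce
      let ?N' = "\<lambda>j. N j - {x}"
      have "\<exists>h. inj_on h (I - {i}) \<and> (\<forall>j\<in>I - {i}. h j \<in> ?N' j)"
      proof (rule less.hyps)
        show "card (I - {i}) < card I" using i less.prems(1) by (rule card_Diff1_less[rotated])
        fix K assume K: "K \<subseteq> I - {i}"
        show "card K \<le> card (\<Union>j\<in>K. ?N' j)"
        proof (cases "K = {}")
          case False
          have "K \<subset> I" using K i by auto
          then have "card (\<Union>j\<in>K. N j) \<noteq> card K"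
            using \<open>\<not> (\<exists>J. J \<subset> I \<and> J \<noteq> {} \<and> card (\<Union>i\<in>J. N i) = card J)\<close> False by blast
          moreover have "card K \<le> card (\<Union>j\<in>K. N j)" using hall[of K] K by blast
          moreover have "(\<Union>j\<in>K. ?N' j) = (\<Union>j\<in>K. N j) - {x}" by blast
          moreover have "card (\<Union>j\<in>K. N j) - 1 \<le> card ((\<Union>j\<in>K. N j) - {x})"
            using diff_card_le_card_Diff[of "{x}" "\<Union>j\<in>K. N j"] by simp
          ultimately show ?thesis by simp
        qed simp
      qed (use less.prems in auto)
      then obtain h where h: "inj_on h (I - {i})" "\<And>j. j \<in> I - {i} \<Longrightarrow> h j \<in> ?N' j" by blast
      have "inj_on (h(i := x)) I"
      proof -
        have "x \<notin> h ` (I - {i})" using h(2) by blast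
        then have "inj_on (h(i := x)) (insert i (I - {i}))"
          using h(1) by (simp add: inj_on_def) (metis Diff_iff image_eqI singletonD)
        then show ?thesis using i by (simp add: insert_absorb)
      qed
      moreover have "(h(i := x)) j \<in> N j" if "j \<in> I" for j using h(2)[of j] that x by auto
      ultimately show ?thesis by blast
    qed simp
  qed
qed

text \<open>
  The elements of \<open>R\<close> are the edges of a bipartite multigraph with ends \<open>f v\<close> and \<open>g v\<close>. In a regular
  graph double counting gives Hall's condition, so a perfect matching exists; it becomes one colour class, and
  removing it leaves a regular graph of smaller degree.
\<close>

lemma regular_edge_colouring:
  fixes f g :: "'v \<Rightarrow> 'c"
  assumes "finite R" "finite M" "f ` R \<subseteq> M" "g ` R \<subseteq> M"
    and "\<And>x. x \<in> M \<Longrightarrow> card {v \<in> R. f v = x} = d" "\<And>x. x \<in> M \<Longrightarrow> card {v \<in> R. g v = x} = d"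
  shows "\<exists>\<kappa>. (\<forall>v\<in>R. \<kappa> v < d) \<and> inj_on (\<lambda>v. (f v, \<kappa> v)) R \<and> inj_on (\<lambda>v. (g v, \<kappa> v)) R"
  using assms
proof (induction d arbitrary: R)
  case 0
  have "v \<notin> R" for v
  proof
    assume v: "v \<in> R"
    then have "f v \<in> M" using 0(3) by blast
    then have "{w \<in> R. f w = f v} = {}" using 0(5)[of "f v"] 0(1) by simp
    then show False using v by blast
  qed
  then have "R = {}" by blast
  then show ?case by simp
next
  case (Suc d)
  let ?N = "\<lambda>x. g ` {v \<in> R. f v = x}"
  have fin: "finite {v \<in> R. P v}" for P using Suc.prems(1) by simp
  have "\<exists>h. inj_on h M \<and> (\<forall>x\<in>M. h x \<in> ?N x)"
  proof (rule hall_marriage)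
    fix J assume J: "J \<subseteq> M"
    then have finJ: "finite J" using Suc.prems(2) finite_subset by blast
    have cardf: "card {v \<in> R. f v \<in> K} = Suc d * card K" if "K \<subseteq> M" "finite K" for K
    proof -
      have "{v \<in> R. f v \<in> K} = (\<Union>x\<in>K. {v \<in> R. f v = x})" by blast
      then have "card {v \<in> R. f v \<in> K} = (\<Sum>x\<in>K. card {v \<in> R. f v = x})"
        using that(2) fin by (simp only:) (rule card_UN_disjoint, auto)
      also have "\<dots> = Suc d * card K" using Suc.prems(5) that(1) by (simp add: subset_iff)
      finally show ?thesis .
    qed
    have cardg: "card {v \<in> R. g v \<in> K} = Suc d * card K" if "K \<subseteq> M" "finite K" for K
    proof -
      have "{v \<in> R. g v \<in> K} = (\<Union>x\<in>K. {v \<in> R. g v = x})" by blast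
      then have "card {v \<in> R. g v \<in> K} = (\<Sum>x\<in>K. card {v \<in> R. g v = x})"
        using that(2) fin by (simp only:) (rule card_UN_disjoint, auto)
      also have "\<dots> = Suc d * card K" using Suc.prems(6) that(1) by (simp add: subset_iff)
      finally show ?thesis .
    qed
    have sub: "(\<Union>x\<in>J. ?N x) \<subseteq> M" using Suc.prems(4) by blast
    have "Suc d * card J = card {v \<in> R. f v \<in> J}" using cardf[OF J finJ] by simp
    also have "\<dots> \<le> card {v \<in> R. g v \<in> (\<Union>x\<in>J. ?N x)}"
      by (rule card_mono[OF fin]) blast
    also have "\<dots> = Suc d * card (\<Union>x\<in>J. ?N x)"
      by (rule cardg[OF sub]) (use sub Suc.prems(2) finite_subset in blast)
    finally show "card J \<le> card (\<Union>x\<in>J. ?N x)" unfolding Suc_mult_le_cancel1 .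
  qed (use Suc.prems in auto)
  then obtain h where h: "inj_on h M" "\<And>x. x \<in> M \<Longrightarrow> h x \<in> ?N x" by blast
  then have "\<forall>x\<in>M. \<exists>v. v \<in> R \<and> f v = x \<and> g v = h x" by fastforce
  then obtain s where s: "\<And>x. x \<in> M \<Longrightarrow> s x \<in> R" "\<And>x. x \<in> M \<Longrightarrow> f (s x) = x"
    "\<And>x. x \<in> M \<Longrightarrow> g (s x) = h x" by (metis (no_types, lifting))
  have hM: "h ` M = M"
    by (rule endo_inj_surj[OF Suc.prems(2) _ h(1)]) (use h(2) Suc.prems(4) in blast)
  let ?R = "R - s ` M"
  have "\<exists>\<kappa>. (\<forall>v\<in>?R. \<kappa> v < d) \<and> inj_on (\<lambda>v. (f v, \<kappa> v)) ?R \<and> inj_on (\<lambda>v. (g v, \<kappa> v)) ?R"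
  proof (rule Suc.IH)
    fix x assume x: "x \<in> M"
    have rest: "{v \<in> ?R. f v = x} = {v \<in> R. f v = x} - {s x}" using s x by auto
    have mem: "s x \<in> {v \<in> R. f v = x}" using s x by simp
    show "card {v \<in> ?R. f v = x} = d"
      unfolding rest using Suc.prems(5)[OF x] card_Diff_singleton[OF mem] by linarith
    have "x \<in> h ` M" unfolding hM by (rule x)
    then obtain y where y: "y \<in> M" "h y = x" by auto
    have rest: "{v \<in> ?R. g v = x} = {v \<in> R. g v = x} - {s y}"
    proof (intro equalityI subsetI)
      fix v assume v: "v \<in> {v \<in> R. g v = x} - {s y}"
      have "v \<noteq> s z" if z: "z \<in> M" for z
      proof
        assume eq: "v = s z"
        then have "h z = h y" using v s(3)[OF z] y(2) by simp
        then have "z = y" using inj_onD[OF h(1) _ z y(1)] by simp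
        then show False using v eq by simp
      qed
      then show "v \<in> {v \<in> ?R. g v = x}" using v by blast
    next
      fix v assume v: "v \<in> {v \<in> ?R. g v = x}"
      then have "v \<noteq> s y" using y(1) by blast
      then show "v \<in> {v \<in> R. g v = x} - {s y}" using v by simp
    qed
    have mem: "s y \<in> {v \<in> R. g v = x}" using s y by simp
    show "card {v \<in> ?R. g v = x} = d"
      unfolding rest using Suc.prems(6)[OF x] card_Diff_singleton[OF mem] by linarith
  qed (use Suc.prems in auto)
  then obtain \<kappa> where \<kappa>: "\<And>v. v \<in> ?R \<Longrightarrow> \<kappa> v < d"
    "inj_on (\<lambda>v. (f v, \<kappa> v)) ?R" "inj_on (\<lambda>v. (g v, \<kappa> v)) ?R" by blast
  let ?k = "\<lambda>v. if v \<in> s ` M then d else \<kappa> v"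
  have inj_f: "inj_on (\<lambda>v. (f v, ?k v)) R"
  proof (rule inj_onI)
    fix v w assume vw: "v \<in> R" "w \<in> R" "(f v, ?k v) = (f w, ?k w)"
    show "v = w"
      by (cases "v \<in> s ` M"; cases "w \<in> s ` M")
        (use vw s \<kappa>(1)[of v] \<kappa>(1)[of w] inj_onD[OF \<kappa>(2), of v w] in auto)
  qed
  have sg: "v = w" if "v \<in> s ` M" "w \<in> s ` M" "g v = g w" for v w
  proof -
    obtain x y where xy: "x \<in> M" "v = s x" "y \<in> M" "w = s y" using \<open>v \<in> s ` M\<close> \<open>w \<in> s ` M\<close> by blast
    then have "h x = h y" using \<open>g v = g w\<close> s(3) by simp
    then have "x = y" by (rule inj_onD[OF h(1)]) fact+
    then show "v = w" using xy by simp
  qed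
  have inj_g: "inj_on (\<lambda>v. (g v, ?k v)) R"
  proof (rule inj_onI)
    fix v w assume vw: "v \<in> R" "w \<in> R" "(g v, ?k v) = (g w, ?k w)"
    show "v = w"
      by (cases "v \<in> s ` M"; cases "w \<in> s ` M")
        (use vw sg[of v w] \<kappa>(1)[of v] \<kappa>(1)[of w] inj_onD[OF \<kappa>(3), of v w] in auto)
  qed
  have "\<forall>v\<in>R. ?k v < Suc d" using \<kappa>(1) by (simp add: less_Suc_eq)
  then show ?case using inj_f inj_g by (intro exI[of _ ?k] conjI)
qed

lemma inj_into_permutes:
  assumes "finite R" "inj_on a R" "a ` R \<subseteq> R"
  shows "(\<lambda>v. if v \<in> R then a v else v) permutes R"
proof (rule inj_imp_permutes)
  show "inj_on (\<lambda>v. if v \<in> R then a v else v) R" using assms(2) by (simp add: inj_on_def)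
qed (use assms in auto)

section \<open>Routing on rectangles\<close>

text \<open>
  A token at \<open>v\<close> has to travel from column \<open>c v\<close> to column \<open>c (p v)\<close>. These pairs form a regular bipartite
  multigraph whose degree is the number of rows. Colour its edges by rows. Then the tokens can first be moved within
  their columns to the row of their colour, then within this row to the column of their destination, and finally
  within that column to the destination. Properness of the colouring says that no two tokens compete for a place.
\<close>

lemma routable_rectangle:
  fixes c :: "'a \<Rightarrow> 'c" and r :: "'a \<Rightarrow> 'r"
  assumes fin: "finite M" "finite Y"
    and bij: "bij_betw (\<lambda>v. (c v, r v)) R (M \<times> Y)"
    and cols: "fibre_routable E R c t" and rows: "fibre_routable E R r t"
  shows "routable E R (3 * t)"
  unfolding routable_def
proof (intro allI impI)
  fix p assume p: "p permutes R"
  have finR: "finite R" using bij fin bij_betw_finite by blast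
  have cR: "c v \<in> M" and rR: "r v \<in> Y" if "v \<in> R" for v
    using bij that unfolding bij_betw_def by blast+
  \<comment> \<open>The vertex in column \<open>x\<close> and row \<open>y\<close>.\<close>
  define pt where "pt = (\<lambda>x y. inv_into R (\<lambda>v. (c v, r v)) (x, y))"
  have pt: "pt x y \<in> R" "c (pt x y) = x" "r (pt x y) = y" if "x \<in> M" "y \<in> Y" for x y
  proof -
    have im: "(x, y) \<in> (\<lambda>v. (c v, r v)) ` R" using bij that unfolding bij_betw_def by blast
    show "pt x y \<in> R" unfolding pt_def by (rule inv_into_into[OF im])
    have "(c (pt x y), r (pt x y)) = (x, y)" unfolding pt_def using f_inv_into_f[OF im] by simp
    then show "c (pt x y) = x" "r (pt x y) = y" by auto
  qed
  have fib: "card {v \<in> R. c v = x} = card Y" if "x \<in> M" for x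
  proof (rule bij_betw_same_card[where f = r])
    show "bij_betw r {v \<in> R. c v = x} Y"
      unfolding bij_betw_def
    proof
      show "inj_on r {v \<in> R. c v = x}"
        using bij unfolding bij_betw_def inj_on_def by auto
      show "r ` {v \<in> R. c v = x} = Y"
      proof (intro equalityI subsetI)
        fix y assume "y \<in> Y"
        then show "y \<in> r ` {v \<in> R. c v = x}" using pt[OF that] by (intro image_eqI[of _ _ "pt x y"]) auto
      qed (use rR in auto)
    qed
  qed
  have fibp: "card {v \<in> R. c (p v) = x} = card Y" if "x \<in> M" for x
  proof -
    have "bij_betw p {v \<in> R. c (p v) = x} {v \<in> R. c v = x}"
    proof (rule bij_betw_imageI)
      show "inj_on p {v \<in> R. c (p v) = x}" using permutes_inj_on[OF p] .
      show "p ` {v \<in> R. c (p v) = x} = {v \<in> R. c v = x}"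
      proof (intro equalityI subsetI)
        fix w assume w: "w \<in> {v \<in> R. c v = x}"
        have "p (inv p w) = w" "inv p w \<in> R"
          using w permutes_inverses(1)[OF p] permutes_in_image[OF permutes_inv[OF p]] by auto
        then show "w \<in> p ` {v \<in> R. c (p v) = x}" using w by (intro image_eqI[of _ _ "inv p w"]) auto
      qed (use permutes_in_image[OF p] in auto)
    qed
    then show ?thesis using fib[OF that] by (simp add: bij_betw_same_card)
  qed
  have "\<exists>\<kappa>. (\<forall>v\<in>R. \<kappa> v < card Y) \<and> inj_on (\<lambda>v. (c v, \<kappa> v)) R
      \<and> inj_on (\<lambda>v. (c (p v), \<kappa> v)) R"
    by (rule regular_edge_colouring[OF finR fin(1) _ _ fib fibp])
      (use cR permutes_in_image[OF p] in auto)
  then obtain \<kappa> where \<kappa>: "\<And>v. v \<in> R \<Longrightarrow> \<kappa> v < card Y" "inj_on (\<lambda>v. (c v, \<kappa> v)) R"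
    "inj_on (\<lambda>v. (c (p v), \<kappa> v)) R" by blast
  obtain e where e: "bij_betw e {..<card Y} Y"
    using fin(2) finite_same_card_bij[of "{..<card Y}" Y] by auto
  \<comment> \<open>\<open>k v\<close> is the row in which the token starting at \<open>v\<close> changes columns; \<open>\<alpha>\<close> moves it there, and \<open>\<delta>\<close> gives its place after the row phase.\<close>
  define k where "k = (\<lambda>v. e (\<kappa> v))"
  have kY: "k v \<in> Y" if "v \<in> R" for v
    using \<kappa>(1)[OF that] e unfolding k_def bij_betw_def by auto
  have keq: "\<kappa> v = \<kappa> w" if "v \<in> R" "w \<in> R" "k v = k w" for v w
    using inj_onD[OF bij_betw_imp_inj_on[OF e]] \<kappa>(1) that unfolding k_def by simp
  define \<alpha> where "\<alpha> = (\<lambda>v. if v \<in> R then pt (c v) (k v) else v)"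
  define \<delta> where "\<delta> = (\<lambda>v. if v \<in> R then pt (c (p v)) (k v) else v)"
  have cp: "c (p v) \<in> M" if "v \<in> R" for v using permutes_in_image[OF p] that cR by simp
  have \<alpha>: "\<alpha> permutes R"
    unfolding \<alpha>_def
  proof (rule inj_into_permutes[OF finR])
    show "inj_on (\<lambda>v. pt (c v) (k v)) R"
    proof (rule inj_onI)
      fix v w assume vw: "v \<in> R" "w \<in> R" "pt (c v) (k v) = pt (c w) (k w)"
      then have "c v = c w" "k v = k w" using pt cR kY by metis+
      then show "v = w" using inj_onD[OF \<kappa>(2), of v w] keq[OF vw(1,2)] vw(1,2) by simp
    qed
  qed (use pt cR kY in auto)
  have \<delta>: "\<delta> permutes R"
    unfolding \<delta>_def
  proof (rule inj_into_permutes[OF finR])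
    show "inj_on (\<lambda>v. pt (c (p v)) (k v)) R"
    proof (rule inj_onI)
      fix v w assume vw: "v \<in> R" "w \<in> R" "pt (c (p v)) (k v) = pt (c (p w)) (k w)"
      then have "c (p v) = c (p w)" "k v = k w" using pt cp kY by metis+
      then show "v = w" using inj_onD[OF \<kappa>(3), of v w] keq[OF vw(1,2)] vw(1,2) by simp
    qed
  qed (use pt cp kY in auto)
  have "realizable E t \<alpha>"
    using cols \<alpha> pt(2) cR kY unfolding fibre_routable_def by (auto simp: \<alpha>_def)
  moreover have "realizable E t (\<delta> \<circ> inv \<alpha>)"
  proof -
    have "r (\<delta> (inv \<alpha> w)) = r w" for w
    proof (cases "w \<in> R")
      case True
      let ?v = "inv \<alpha> w"
      have v: "?v \<in> R" "\<alpha> ?v = w"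
        using True permutes_in_image[OF permutes_inv[OF \<alpha>]] permutes_inverses(1)[OF \<alpha>] by auto
      have "r (\<delta> ?v) = r (\<alpha> ?v)" using v(1) pt(3) cR cp kY by (simp add: \<alpha>_def \<delta>_def)
      then show ?thesis using v(2) by simp
    next
      case False
      then show ?thesis using permutes_not_in[OF permutes_inv[OF \<alpha>]] by (simp add: \<delta>_def)
    qed
    then show ?thesis
      using rows permutes_compose[OF permutes_inv[OF \<alpha>] \<delta>] unfolding fibre_routable_def by simp
  qed
  moreover have "realizable E t (p \<circ> inv \<delta>)"
  proof -
    have "c (p (inv \<delta> w)) = c w" for w
    proof (cases "w \<in> R")
      case True
      let ?v = "inv \<delta> w"
      have v: "?v \<in> R" "\<delta> ?v = w"
        using True permutes_in_image[OF permutes_inv[OF \<delta>]] permutes_inverses(1)[OF \<delta>] by auto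
      have "c (\<delta> ?v) = c (p ?v)" using v(1) pt(2) cp kY by (simp add: \<delta>_def)
      then show ?thesis using v(2) by simp
    next
      case False
      then show ?thesis using permutes_not_in[OF permutes_inv[OF \<delta>]] permutes_not_in[OF p] by simp
    qed
    then show ?thesis
      using cols permutes_compose[OF permutes_inv[OF \<delta>] p] unfolding fibre_routable_def by simp
  qed
  ultimately have "realizable E (t + (t + t)) ((p \<circ> inv \<delta>) \<circ> ((\<delta> \<circ> inv \<alpha>) \<circ> \<alpha>))"
    by (intro realizable_comp)
  moreover have "(p \<circ> inv \<delta>) \<circ> ((\<delta> \<circ> inv \<alpha>) \<circ> \<alpha>) = p"
    by (rule ext) (simp add: permutes_inverses(2)[OF \<alpha>] permutes_inverses(2)[OF \<delta>])
  ultimately show "realizable E (3 * t) p" by (simp add: numeral_3_eq_3)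
qed

section \<open>Extending a routable set along fibres\<close>

definition swap_along :: "('a \<Rightarrow> 'a) \<Rightarrow> 'a set \<Rightarrow> 'a \<Rightarrow> 'a" where
  "swap_along \<sigma> Y v = (if v \<in> Y then \<sigma> v else if v \<in> \<sigma> ` Y then inv_into Y \<sigma> v else v)"

lemma swap_along:
  assumes inj: "inj_on \<sigma> Y" and disj: "Y \<inter> \<sigma> ` Y = {}"
  shows swap_along_dom: "v \<in> Y \<Longrightarrow> swap_along \<sigma> Y v = \<sigma> v"
    and swap_along_img: "v \<in> Y \<Longrightarrow> swap_along \<sigma> Y (\<sigma> v) = v"
    and swap_along_other: "v \<notin> Y \<Longrightarrow> v \<notin> \<sigma> ` Y \<Longrightarrow> swap_along \<sigma> Y v = v"
    and swap_along_invol: "swap_along \<sigma> Y (swap_along \<sigma> Y v) = v"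
proof -
  show dom: "swap_along \<sigma> Y v = \<sigma> v" if "v \<in> Y" for v
    using that by (simp add: swap_along_def)
  show img: "swap_along \<sigma> Y (\<sigma> v) = v" if "v \<in> Y" for v
  proof -
    have "\<sigma> v \<notin> Y" using that disj by blast
    then show ?thesis using that inj by (simp add: swap_along_def)
  qed
  show other: "swap_along \<sigma> Y v = v" if "v \<notin> Y" "v \<notin> \<sigma> ` Y" for v
    using that by (simp add: swap_along_def)
  show "swap_along \<sigma> Y (swap_along \<sigma> Y v) = v"
  proof (cases "v \<in> Y")
    case True
    then show ?thesis by (simp add: dom img)
  next
    case False
    show ?thesis
    proof (cases "v \<in> \<sigma> ` Y")
      case True
      then obtain w where w: "w \<in> Y" "v = \<sigma> w" by blast
      show ?thesis unfolding w(2) img[OF w(1)] by (rule dom[OF w(1)])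
    qed (simp add: other False)
  qed
qed

lemma swap_along_realizable:
  assumes rout: "fibre_routable E V f t" and inj: "inj_on \<sigma> Y" and disj: "Y \<inter> \<sigma> ` Y = {}"
    and V: "Y \<subseteq> V" "\<sigma> ` Y \<subseteq> V" and f: "\<And>v. v \<in> Y \<Longrightarrow> f (\<sigma> v) = f v"
  shows "realizable E t (swap_along \<sigma> Y)"
proof -
  have "swap_along \<sigma> Y permutes V"
    by (rule inverse_supported_permutes[where g = "swap_along \<sigma> Y"])
      (use V swap_along_invol[OF inj disj] swap_along_other[OF inj disj] in \<open>simp_all add: subset_iff\<close>, blast)
  moreover have "f (swap_along \<sigma> Y v) = f v" for v
  proof (cases "v \<in> Y")
    case True
    then show ?thesis using f swap_along_dom[OF inj disj] by simp
  next
    case False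
    show ?thesis
    proof (cases "v \<in> \<sigma> ` Y")
      case True
      then obtain w where w: "w \<in> Y" "v = \<sigma> w" by blast
      show ?thesis unfolding w(2) swap_along_img[OF inj disj w(1)] using f[OF w(1)] by simp
    qed (simp add: swap_along_other[OF inj disj] False)
  qed
  ultimately show ?thesis using rout unfolding fibre_routable_def by blast
qed

lemma ex_permutes_image:
  assumes "finite A" "X \<subseteq> A" "Z \<subseteq> A" "card X = card Z"
  shows "\<exists>a. a permutes A \<and> a ` X = Z"
proof -
  have fin: "finite X" "finite Z" using assms finite_subset by blast+
  obtain b1 where b1: "bij_betw b1 X Z" using finite_same_card_bij[OF fin assms(4)] by blast
  have "card (A - X) = card (A - Z)" using assms fin by (simp add: card_Diff_subset)
  then obtain b2 where b2: "bij_betw b2 (A - X) (A - Z)"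
    using finite_same_card_bij[of "A - X" "A - Z"] assms(1) by blast
  define a where "a = (\<lambda>v. if v \<in> X then b1 v else if v \<in> A then b2 v else v)"
  have aX: "bij_betw a X Z"
    by (rule bij_betw_cong[THEN iffD1, OF _ b1]) (simp add: a_def)
  have "bij_betw a (A - X) (A - Z)"
    by (rule bij_betw_cong[THEN iffD1, OF _ b2]) (simp add: a_def)
  then have "bij_betw a (X \<union> (A - X)) (Z \<union> (A - Z))"
    using bij_betw_combine[OF aX, of "A - X" "A - Z"] by blast
  moreover have "X \<union> (A - X) = A" "Z \<union> (A - Z) = A" using assms by blast+
  ultimately have "a permutes A" by (intro bij_imp_permutes) (use assms(2) in \<open>auto simp: a_def\<close>)
  then show ?thesis using aX unfolding bij_betw_def by blast
qed

text \<open>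
  First the tokens \<open>X\<close> of \<open>A\<close> that belong to \<open>S\<close> are moved, inside \<open>A\<close>, to the partners of the vertices \<open>Y\<close> of \<open>S\<close>
  whose tokens belong to \<open>A\<close>; there are equally many of both. A partial swap along \<open>\<sigma>\<close> exchanges them. What
  remains is a permutation of \<open>A\<close> and one of \<open>S\<close>; the latter is performed by carrying \<open>S\<close> over to its
  copy \<open>\<sigma> ` S\<close> in \<open>A\<close>, permuting there, and swapping back.
\<close>

lemma routable_extend:
  assumes fin: "finite A" "finite S" and disj: "A \<inter> S = {}"
    and A: "routable E A T" and V: "fibre_routable E V f t" "A \<union> S \<subseteq> V"
    and inj: "inj_on \<sigma> S" and \<sigma>A: "\<sigma> ` S \<subseteq> A" and f: "\<And>v. v \<in> S \<Longrightarrow> f (\<sigma> v) = f v"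
  shows "routable E (A \<union> S) (3 * T + 3 * t)"
  unfolding routable_def
proof (intro allI impI)
  fix p assume p: "p permutes A \<union> S"
  define X where "X = {v \<in> A. p v \<in> S}"
  define Y where "Y = {v \<in> S. p v \<in> A}"
  have XA: "X \<subseteq> A" and YS: "Y \<subseteq> S" unfolding X_def Y_def by auto
  have finX: "finite X" and finY: "finite Y" using XA YS fin finite_subset by auto
  have injY: "inj_on \<sigma> Y" using inj YS inj_on_subset by blast
  have \<sigma>Y: "\<sigma> ` Y \<subseteq> A" using \<sigma>A YS by blast
  have disjY: "Y \<inter> \<sigma> ` Y = {}" using \<sigma>Y YS disj by blast
  have disjS: "S \<inter> \<sigma> ` S = {}" using \<sigma>A disj by blast
  have injp: "inj_on p B" for B using permutes_inj_on[OF p] .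
  have pAS: "p v \<in> A \<union> S \<longleftrightarrow> v \<in> A \<union> S" for v by (rule permutes_in_image[OF p])
  \<comment> \<open>As \<open>p\<close> permutes \<open>A \<union> S\<close>, as many tokens enter \<open>S\<close> as leave it.\<close>
  have "card X = card Y"
  proof -
    have "p ` X \<union> p ` (S - Y) = S"
    proof (intro equalityI subsetI)
      fix w assume w: "w \<in> S"
      define v where "v = inv p w"
      have pv: "p v = w" unfolding v_def by (rule permutes_inverses(1)[OF p])
      then have "v \<in> A \<union> S" using pAS[of v] w by blast
      moreover have "w \<notin> A" using w disj by blast
      ultimately have "v \<in> X \<or> v \<in> S - Y" unfolding X_def Y_def using pv w by blast
      then show "w \<in> p ` X \<union> p ` (S - Y)" using pv by blast
    next
      fix w assume "w \<in> p ` X \<union> p ` (S - Y)"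
      then obtain v where v: "v \<in> X \<or> v \<in> S - Y" "w = p v" by blast
      then show "w \<in> S" unfolding X_def Y_def using pAS[of v] by blast
    qed
    moreover have "p ` X \<inter> p ` (S - Y) = {}"
      using XA disj inj_onD[OF injp[of UNIV]] by blast
    ultimately have "card S = card (p ` X) + card (p ` (S - Y))"
      using card_Un_disjoint[of "p ` X" "p ` (S - Y)"] finX fin(2) by simp
    also have "\<dots> = card X + (card S - card Y)"
      using card_image[OF injp] card_Diff_subset[OF finY YS] by simp
    finally show ?thesis using card_mono[OF fin(2) YS] by simp
  qed
  then have "card X = card (\<sigma> ` Y)" using card_image[OF injY] by simp
  then obtain a where a: "a permutes A" "a ` X = \<sigma> ` Y"
    using ex_permutes_image[OF fin(1) XA \<sigma>Y] by blast
  define \<tau> where "\<tau> = swap_along \<sigma> Y"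
  \<comment> \<open>What is left to do after the rounds for \<open>a\<close> and \<open>\<tau>\<close>; it preserves \<open>A\<close> and \<open>S\<close>.\<close>
  define r where "r = p \<circ> (inv a \<circ> \<tau>)"
  have \<tau>: "realizable E t \<tau>" unfolding \<tau>_def
    by (rule swap_along_realizable[OF V(1) injY disjY]) (use V(2) YS \<sigma>Y f in auto)
  have \<tau>perm: "\<tau> permutes A \<union> S"
  proof (rule inverse_supported_permutes[where g = \<tau>])
    show "\<tau> (\<tau> v) = v" "\<tau> (\<tau> v) = v" for v
      unfolding \<tau>_def by (rule swap_along_invol[OF injY disjY])+
    show "\<tau> v = v" if "v \<notin> A \<union> S" for v
      unfolding \<tau>_def by (rule swap_along_other[OF injY disjY]) (use that YS \<sigma>Y in auto)
  qed
  have "a permutes A \<union> S" using a(1) permutes_subset by blast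
  then have rperm: "r permutes A \<union> S"
    unfolding r_def by (intro permutes_compose p permutes_inv \<tau>perm)
  have rS: "r w \<in> S" if w: "w \<in> S" for w
  proof (cases "w \<in> Y")
    case True
    then have "\<tau> w \<in> a ` X" unfolding a(2) \<tau>_def swap_along_dom[OF injY disjY True] by blast
    then obtain x where x: "x \<in> X" "\<tau> w = a x" by blast
    then have "r w = p x" unfolding r_def by (simp add: permutes_inverses(2)[OF a(1)])
    then show ?thesis using x(1) unfolding X_def by simp
  next
    case False
    have wA: "w \<notin> A" using w disj by blast
    then have "w \<notin> \<sigma> ` Y" using \<sigma>Y by blast
    then have "\<tau> w = w" unfolding \<tau>_def using swap_along_other[OF injY disjY] False by simp
    then have "r w = p w" unfolding r_def using permutes_not_in[OF permutes_inv[OF a(1)] wA] by simp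
    then show ?thesis using pAS[of w] w False unfolding Y_def by auto
  qed
  define rS where "rS = (\<lambda>v. if v \<in> S then r v else v)"
  define rA where "rA = (\<lambda>v. if v \<in> A then r v else v)"
  have rSp: "rS permutes S"
    unfolding rS_def by (rule inj_into_permutes[OF fin(2) permutes_inj_on[OF rperm]]) (use rS in auto)
  have rA: "r w \<in> A" if w: "w \<in> A" for w
  proof -
    have "r w \<notin> S"
    proof
      assume "r w \<in> S"
      define v where "v = inv rS (r w)"
      have v: "rS v = r w" unfolding v_def by (rule permutes_inverses(1)[OF rSp])
      then have vS: "v \<in> S" using permutes_in_image[OF rSp, of v] \<open>r w \<in> S\<close> by simp
      then have "r v = r w" using v unfolding rS_def by simp
      then have "v = w" using permutes_inj[OF rperm] by (simp add: inj_eq)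
      then show False using vS w disj by blast
    qed
    then show ?thesis using permutes_in_image[OF rperm, of w] w by blast
  qed
  have rAp: "rA permutes A"
    unfolding rA_def by (rule inj_into_permutes[OF fin(1) permutes_inj_on[OF rperm]]) (use rA in auto)
  have r_split: "r = rA \<circ> rS"
  proof
    fix v
    consider "v \<in> A" "v \<notin> S" | "v \<in> S" "v \<notin> A" | "v \<notin> A \<union> S" using disj by blast
    then show "r v = (rA \<circ> rS) v"
    proof cases
      case 2
      then have "r v \<notin> A" using rS[of v] disj by blast
      then show ?thesis using 2 unfolding rA_def rS_def by simp
    qed (use permutes_not_in[OF rperm] in \<open>auto simp: rA_def rS_def\<close>)
  qed
  \<comment> \<open>Conjugation by the full swap turns the permutation of \<open>S\<close> into one of \<open>A\<close>.\<close>
  define \<mu> where "\<mu> = swap_along \<sigma> S"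
  have \<mu>: "realizable E t \<mu>" unfolding \<mu>_def
    by (rule swap_along_realizable[OF V(1) inj disjS]) (use V(2) \<sigma>A f in auto)
  have \<mu>\<mu>: "\<mu> (\<mu> v) = v" for v unfolding \<mu>_def by (rule swap_along_invol[OF inj disjS])
  have "\<mu> \<circ> (rS \<circ> \<mu>) permutes A"
  proof (rule inverse_supported_permutes[where g = "\<mu> \<circ> (inv rS \<circ> \<mu>)"])
    show "(\<mu> \<circ> (inv rS \<circ> \<mu>)) ((\<mu> \<circ> (rS \<circ> \<mu>)) v) = v" "(\<mu> \<circ> (rS \<circ> \<mu>)) ((\<mu> \<circ> (inv rS \<circ> \<mu>)) v) = v" for v
      by (simp_all add: \<mu>\<mu> permutes_inverses[OF rSp])
    fix v assume v: "v \<notin> A"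
    have "\<mu> v \<notin> S"
    proof (cases "v \<in> S")
      case True
      then have "\<mu> v \<in> A" unfolding \<mu>_def swap_along_dom[OF inj disjS True] using \<sigma>A by blast
      then show ?thesis using disj by blast
    next
      case False
      moreover have "v \<notin> \<sigma> ` S" using v \<sigma>A by blast
      ultimately show ?thesis unfolding \<mu>_def using swap_along_other[OF inj disjS] by simp
    qed
    then show "(\<mu> \<circ> (rS \<circ> \<mu>)) v = v" unfolding rS_def by (simp add: \<mu>\<mu>)
  qed
  then have "realizable E T (\<mu> \<circ> (rS \<circ> \<mu>))" using A unfolding routable_def by blast
  then have "realizable E (t + (T + t)) (\<mu> \<circ> ((\<mu> \<circ> (rS \<circ> \<mu>)) \<circ> \<mu>))"
    using \<mu> by (intro realizable_comp)
  moreover have "\<mu> \<circ> ((\<mu> \<circ> (rS \<circ> \<mu>)) \<circ> \<mu>) = rS" by (rule ext) (simp add: \<mu>\<mu>)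
  ultimately have S_real: "realizable E (t + (T + t)) rS" by simp
  have A_real: "realizable E T rA" "realizable E T a" using A rAp a(1) unfolding routable_def by auto
  have "realizable E (T + ((t + (T + t)) + (t + T))) (rA \<circ> (rS \<circ> (\<tau> \<circ> a)))"
    by (intro realizable_comp A_real S_real \<tau>)
  moreover have "rA \<circ> (rS \<circ> (\<tau> \<circ> a)) = p"
  proof
    fix v
    have "(rA \<circ> (rS \<circ> (\<tau> \<circ> a))) v = r (\<tau> (a v))" unfolding r_split by simp
    also have "\<dots> = p v"
      unfolding r_def by (simp add: \<tau>_def swap_along_invol[OF injY disjY] permutes_inverses(2)[OF a(1)])
    finally show "(rA \<circ> (rS \<circ> (\<tau> \<circ> a))) v = p v" .
  qed
  moreover have "T + ((t + (T + t)) + (t + T)) = 3 * T + 3 * t" by simp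
  ultimately show "realizable E (3 * T + 3 * t) p" by metis
qed

text \<open>
  In one application of \<open>routable_extend\<close> every fibre of \<open>A\<close> can be doubled, or completed if less than a
  doubling is missing. So \<open>m\<close> applications suffice if \<open>A\<close> contains the fraction \<open>1 / 2 ^ m\<close> of every fibre. The
  recursion \<open>T \<mapsto> 3 T + 3 t\<close> for the cost is bounded by \<open>3 ^ m * (T + 2 t)\<close>.
\<close>

lemma routable_fill:
  assumes fin: "finite V" and V: "fibre_routable E V f t"
    and "A \<subseteq> V" "routable E A T"
    and "\<And>x. card {v \<in> V. f v = x} \<le> 2 ^ m * card {v \<in> A. f v = x}"
  shows "routable E V (3 ^ m * (T + 2 * t))"
  using assms(3-)
proof (induction m arbitrary: A T)
  case 0
  have "V \<subseteq> A"
  proof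
    fix v assume v: "v \<in> V"
    have "{w \<in> A. f w = f v} = {w \<in> V. f w = f v}"
      by (rule card_seteq) (use fin 0 in auto)
    moreover have "v \<in> {w \<in> V. f w = f v}" using v by simp
    ultimately show "v \<in> A" by blast
  qed
  then have "V = A" using 0(1) by blast
  then show ?case using 0(2) unfolding routable_def by (auto intro: realizable_mono)
next
  case (Suc m)
  have finA: "finite A" using Suc.prems(1) fin finite_subset by blast
  have "\<forall>x. \<exists>S \<sigma>. S \<subseteq> {v \<in> V - A. f v = x} \<and> inj_on \<sigma> S \<and> \<sigma> ` S \<subseteq> {v \<in> A. f v = x}
      \<and> card {v \<in> V. f v = x} \<le> 2 ^ m * (card {v \<in> A. f v = x} + card S)"
  proof
    fix x
    let ?V = "{v \<in> V. f v = x}" and ?A = "{v \<in> A. f v = x}" and ?D = "{v \<in> V - A. f v = x}"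
    have finA': "finite ?A" and finD: "finite ?D" using finA fin by auto
    have cardV: "card ?V = card ?A + card ?D"
    proof -
      have "?V = ?A \<union> ?D" using Suc.prems(1) by blast
      then show ?thesis using card_Un_disjoint[OF finA' finD] by force
    qed
    have inj: "\<exists>\<sigma>. inj_on \<sigma> S \<and> \<sigma> ` S \<subseteq> ?A" if "S \<subseteq> ?D" "card S \<le> card ?A" for S
      using card_le_inj[of S ?A] finite_subset[OF that(1) finD] finA' that(2) by blast
    show "\<exists>S \<sigma>. S \<subseteq> ?D \<and> inj_on \<sigma> S \<and> \<sigma> ` S \<subseteq> ?A \<and> card ?V \<le> 2 ^ m * (card ?A + card S)"
    proof (cases "card ?D \<le> card ?A")
      case True
      have "1 * card ?V \<le> 2 ^ m * card ?V" by (rule mult_le_mono1) simp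
      then have "card ?V \<le> 2 ^ m * (card ?A + card ?D)" unfolding cardV by simp
      moreover obtain \<sigma> where "inj_on \<sigma> ?D \<and> \<sigma> ` ?D \<subseteq> ?A" using inj[OF subset_refl True] ..
      ultimately show ?thesis by (intro exI[of _ ?D] exI[of _ \<sigma>]) blast
    next
      case False
      then obtain S where S: "S \<subseteq> ?D" "card S = card ?A"
        using obtain_subset_with_card_n[of "card ?A" ?D] by auto
      have "card ?V \<le> 2 ^ m * (card ?A + card S)" using Suc.prems(3)[of x] unfolding S(2)
        by (simp add: algebra_simps)
      moreover obtain \<sigma> where "inj_on \<sigma> S \<and> \<sigma> ` S \<subseteq> ?A" using inj[OF S(1)] S(2) by auto
      ultimately show ?thesis using S(1) by (intro exI[of _ S] exI[of _ \<sigma>]) blast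
    qed
  qed
  from choice[OF this] obtain S where "\<forall>x. \<exists>\<sigma>. S x \<subseteq> {v \<in> V - A. f v = x} \<and> inj_on \<sigma> (S x)
      \<and> \<sigma> ` S x \<subseteq> {v \<in> A. f v = x}
      \<and> card {v \<in> V. f v = x} \<le> 2 ^ m * (card {v \<in> A. f v = x} + card (S x))" ..
  from choice[OF this] obtain \<sigma> where S\<sigma>: "\<forall>x. S x \<subseteq> {v \<in> V - A. f v = x} \<and> inj_on (\<sigma> x) (S x)
      \<and> \<sigma> x ` S x \<subseteq> {v \<in> A. f v = x}
      \<and> card {v \<in> V. f v = x} \<le> 2 ^ m * (card {v \<in> A. f v = x} + card (S x))" ..
  have S: "S x \<subseteq> {v \<in> V - A. f v = x}" "inj_on (\<sigma> x) (S x)" "\<sigma> x ` S x \<subseteq> {v \<in> A. f v = x}"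
    "card {v \<in> V. f v = x} \<le> 2 ^ m * (card {v \<in> A. f v = x} + card (S x))" for x
    using S\<sigma> by blast+
  define U where "U = (\<Union>x. S x)"
  define \<mu> where "\<mu> = (\<lambda>v. \<sigma> (f v) v)"
  have U: "v \<in> S (f v)" if v: "v \<in> U" for v
  proof -
    obtain x where "v \<in> S x" using v unfolding U_def by blast
    moreover from this have "f v = x" using S(1)[of x] by blast
    ultimately show ?thesis by simp
  qed
  have UV: "U \<subseteq> V - A" using U S(1) by blast
  have \<mu>: "\<mu> v \<in> A" "f (\<mu> v) = f v" if "v \<in> U" for v
    using S(3)[of "f v"] U[OF that] unfolding \<mu>_def by blast+
  have "routable E (A \<union> U) (3 * T + 3 * t)"
  proof (rule routable_extend[OF finA _ _ Suc.prems(2) V])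
    show "finite U" using UV fin finite_subset by blast
    show "inj_on \<mu> U"
    proof (rule inj_onI)
      fix v w assume vw: "v \<in> U" "w \<in> U" "\<mu> v = \<mu> w"
      then have fvw: "f v = f w" using \<mu>(2)[of v] \<mu>(2)[of w] by simp
      then have "\<sigma> (f w) v = \<sigma> (f w) w" using vw(3) unfolding \<mu>_def by simp
      then show "v = w" using inj_onD[OF S(2)[of "f w"]] U[OF vw(1)] U[OF vw(2)] fvw by simp
    qed
  qed (use UV Suc.prems(1) \<mu> in auto)
  moreover have "card {v \<in> V. f v = x} \<le> 2 ^ m * card {v \<in> A \<union> U. f v = x}" for x
  proof -
    have "S x \<subseteq> {v \<in> U. f v = x}" using S(1)[of x] unfolding U_def by blast
    then have "card {v \<in> A. f v = x} + card (S x) \<le> card {v \<in> A. f v = x} + card {v \<in> U. f v = x}"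
      using UV fin by (intro add_left_mono card_mono) (auto intro: finite_subset[of _ V])
    also have "\<dots> = card ({v \<in> A. f v = x} \<union> {v \<in> U. f v = x})"
      using UV finA fin by (intro card_Un_disjoint[symmetric]) (auto intro: finite_subset[of _ V])
    also have "{v \<in> A. f v = x} \<union> {v \<in> U. f v = x} = {v \<in> A \<union> U. f v = x}" by blast
    finally show ?thesis using S(4)[of x] mult_le_mono2 le_trans by blast
  qed
  ultimately have "routable E V (3 ^ m * ((3 * T + 3 * t) + 2 * t))"
    by (intro Suc.IH) (use UV Suc.prems(1) in auto)
  moreover have "3 ^ m * ((3 * T + 3 * t) + 2 * t) \<le> 3 ^ Suc m * (T + 2 * t)" by (simp add: algebra_simps)
  ultimately show ?case unfolding routable_def by (auto intro: realizable_mono)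
qed

section \<open>Simulating swaps along sheared rows\<close>

text \<open>
  Two vertices joined by a walk are exchanged by conjugating with the swaps along the walk, two more
  rounds for each further edge.
\<close>

lemma realizable_transpose_extend:
  assumes "realizable E k (Transposition.transpose u w)" "{w, v} \<in> E"
  shows "realizable E (k + 2) (Transposition.transpose u v)"
proof -
  have step: "realizable E 1 (Transposition.transpose v w)"
    using assms(2) by (intro realizable_swap_round swap_round_transpose) (simp add: insert_commute)
  consider "u = v" | "u = w" | "v \<noteq> u" "w \<noteq> u" by blast
  then show ?thesis
  proof cases
    case 1
    show ?thesis unfolding 1 transpose_same by (rule realizable_id)
  next
    case 2
    show ?thesis unfolding 2 transpose_commute[of w v] by (rule realizable_mono[OF step]) simp
  next
    case 3
    have "realizable E (1 + k + 1)
      (Transposition.transpose v w \<circ> Transposition.transpose w u \<circ> Transposition.transpose v w)"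
      using step assms(1) transpose_commute by (metis realizable_comp)
    then show ?thesis unfolding transpose_comp_triple[OF 3] transpose_commute[of v u] by simp
  qed
qed

text \<open>
  A round \<open>q\<close> whose swaps are not along edges can still be performed if each swap \<open>v\<close>, \<open>q v\<close> has its own cheap
  realization inside a neighbourhood \<open>N v\<close>: colour the swaps such that neighbourhoods of equal colour are disjoint,
  and perform one colour after the other. \<open>P k\<close> are the swaps of colour \<open>k\<close>, \<open>Q k\<close> those of colour less than \<open>k\<close>.
\<close>

lemma realizable_simulate:
  assumes invol: "\<And>v. q (q v) = v"
    and \<kappa>: "\<And>v. q v \<noteq> v \<Longrightarrow> \<kappa> v < K" "\<And>v. \<kappa> (q v) = \<kappa> v"
    and N: "\<And>v. q v \<noteq> v \<Longrightarrow> v \<in> N v" "\<And>v. N (q v) = N v"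
    and disj: "\<And>v w. q v \<noteq> v \<Longrightarrow> q w \<noteq> w \<Longrightarrow> \<kappa> v = \<kappa> w \<Longrightarrow> w \<noteq> v \<Longrightarrow> w \<noteq> q v \<Longrightarrow> N v \<inter> N w = {}"
    and real: "\<And>v. q v \<noteq> v \<Longrightarrow> realizable {e \<in> E. e \<subseteq> N v} r (Transposition.transpose v (q v))"
  shows "realizable E (K * r) q"
proof -
  define P where "P = (\<lambda>k v. if \<kappa> v = k then q v else v)"
  define Q where "Q = (\<lambda>k v. if \<kappa> v < k then q v else v)"
  have P: "realizable E r (P k)" for k
  proof -
    define act where "act = (\<lambda>X u. q u \<noteq> u \<and> \<kappa> u = k \<and> N u = X)"
    \<comment> \<open>The parts for parallel execution are the neighbourhoods of colour \<open>k\<close>; all vertices outside of them form the part with index \<open>{}\<close>, where nothing happens.\<close>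
    define idx where "idx = (\<lambda>v. SOME X. v \<in> X \<and> (\<exists>u. act X u) \<or> X = {} \<and> (\<forall>u. act (N u) u \<longrightarrow> v \<notin> N u))"
    define p where "p = (\<lambda>X. if \<exists>u. act X u then
      Transposition.transpose (SOME u. act X u) (q (SOME u. act X u)) else id)"
    have idx: "v \<in> idx v \<and> (\<exists>u. act (idx v) u) \<or> idx v = {} \<and> (\<forall>u. act (N u) u \<longrightarrow> v \<notin> N u)" for v
      unfolding idx_def by (rule someI_ex) (auto simp: act_def)
    have same: "w = u \<or> w = q u" if "act X u" "act Y w" "v \<in> X" "v \<in> Y" for X Y u w v
    proof (rule ccontr)
      assume "\<not> (w = u \<or> w = q u)"
      then have "N u \<inter> N w = {}" using disj[of u w] that(1,2) unfolding act_def by simp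
      then show False using that unfolding act_def by blast
    qed
    have act_eq: "X = Y" if uw: "act X u" "act Y w" "v \<in> X" "v \<in> Y" for X Y u w v
      using same[OF uw] uw(1,2) N(2)[of u] unfolding act_def by auto
    have fibre: "{v. idx v = X} = X" if X: "act X u" for X u
    proof (intro equalityI subsetI)
      fix v assume v: "v \<in> X"
      have "act (N u) u" "v \<in> N u" using X v unfolding act_def by auto
      then have "v \<in> idx v \<and> (\<exists>w. act (idx v) w)" using idx[of v] by blast
      then show "v \<in> {v. idx v = X}" using act_eq[OF X _ v] by blast
    next
      fix v assume "v \<in> {v. idx v = X}"
      then have v: "idx v = X" by simp
      have "u \<in> X" using X N(1) unfolding act_def by blast
      then show "v \<in> X" using idx[of v] unfolding v by blast
    qed
    have "realizable E r (\<lambda>v. p (idx v) v)"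
    proof (rule realizable_parallel[where p = p and idx = idx])
      fix X
      show "realizable {e \<in> E. e \<subseteq> {v. idx v = X}} r (p X)"
      proof (cases "\<exists>u. act X u")
        case True
        define u where "u = (SOME u. act X u)"
        have u: "act X u" unfolding u_def using True by (rule someI_ex)
        have pX: "p X = Transposition.transpose u (q u)" unfolding p_def u_def using True by simp
        have "realizable {e \<in> E. e \<subseteq> N u} r (Transposition.transpose u (q u))"
          using real u unfolding act_def by blast
        moreover have "N u = X" using u unfolding act_def by blast
        ultimately show ?thesis unfolding pX fibre[OF u] by simp
      next
        case False
        show ?thesis unfolding p_def if_not_P[OF False] by (rule realizable_id)
      qed
    qed
    moreover have "p (idx v) v = P k v" for v
    proof (cases "\<exists>u. act (idx v) u")
      case True
      define u where "u = (SOME u. act (idx v) u)"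
      have u: "act (idx v) u" unfolding u_def using True by (rule someI_ex)
      have p: "p (idx v) = Transposition.transpose u (q u)" unfolding p_def u_def using True by simp
      have "u \<in> idx v" using u N(1) unfolding act_def by blast
      then have v: "v \<in> idx v" using idx[of v] by blast
      show ?thesis
      proof (cases "v = u \<or> v = q u")
        case True
        then show ?thesis using u \<kappa>(2)[of u] invol[of u] unfolding p P_def act_def by auto
      next
        case False
        have "q v = v" if k: "\<kappa> v = k"
        proof (rule ccontr)
          assume "q v \<noteq> v"
          then have "act (N v) v" "v \<in> N v" using k N(1) unfolding act_def by auto
          then show False using same[OF u _ v] False by blast
        qed
        then show ?thesis using False unfolding p P_def by simp
      qed
    next
      case False
      then have none: "\<forall>u. act (N u) u \<longrightarrow> v \<notin> N u" using idx[of v] by blast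
      have "q v = v" if k: "\<kappa> v = k"
        using none N(1)[of v] k unfolding act_def by blast
      then show ?thesis unfolding p_def P_def if_not_P[OF False] by simp
    qed
    ultimately show ?thesis by simp
  qed
  have "realizable E (k * r) (Q k)" for k
  proof (induction k)
    case 0
    have "Q 0 = id" unfolding Q_def by (rule ext) simp
    then show ?case using realizable_id by metis
  next
    case (Suc k)
    have split: "Q (Suc k) = P k \<circ> Q k"
      unfolding P_def Q_def using \<kappa>(2) by (auto simp: fun_eq_iff less_Suc_eq)
    show ?case unfolding split mult_Suc by (rule realizable_comp[OF P Suc])
  qed
  moreover have "Q K = q"
  proof
    show "Q K v = q v" for v using \<kappa>(1)[of v] unfolding Q_def by (cases "q v = v") simp_all
  qed
  ultimately show ?thesis by metis
qed

definition lattice_edges :: "(int \<times> int) set \<Rightarrow> (int \<times> int) set set" where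
  "lattice_edges L = {{u, v} | u v. u \<in> L \<and> v \<in> L \<and> \<bar>fst u - fst v\<bar> + \<bar>snd u - snd v\<bar> = 1}"

text \<open>
  Consecutive vertices of equal height above the spine \<open>c\<close>. They are in general not adjacent in the lattice.
\<close>

definition sheared_edges :: "(int \<times> int) set \<Rightarrow> (int \<Rightarrow> int) \<Rightarrow> (int \<times> int) set set" where
  "sheared_edges L c = {{(i, c i + y), (i + 1, c (i + 1) + y)} | i y.
     (i, c i + y) \<in> L \<and> (i + 1, c (i + 1) + y) \<in> L}"

lemma realizable_climb:
  assumes "realizable E k (Transposition.transpose u (i, j))"
    and "\<And>l. j \<le> l \<Longrightarrow> l \<le> j + int n \<Longrightarrow> (i, l) \<in> L" "{e \<in> lattice_edges L. e \<subseteq> X} \<subseteq> E"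
    and "\<And>l. j \<le> l \<Longrightarrow> l \<le> j + int n \<Longrightarrow> (i, l) \<in> X"
  shows "realizable E (k + 2 * n) (Transposition.transpose u (i, j + int n))"
  using assms(2,4)
proof (induction n)
  case 0
  then show ?case using assms(1) by simp
next
  case (Suc n)
  have "realizable E (k + 2 * n) (Transposition.transpose u (i, j + int n))"
    by (rule Suc.IH) (use Suc.prems in auto)
  moreover have "{(i, j + int n), (i, j + int (Suc n))} \<in> E"
  proof (rule subsetD[OF assms(3)], safe)
    have "(i, j + int n) \<in> L" "(i, j + int (Suc n)) \<in> L"
      using Suc.prems(1)[of "j + int n"] Suc.prems(1)[of "j + int (Suc n)"] by auto
    then show "{(i, j + int n), (i, j + int (Suc n))} \<in> lattice_edges L"
      unfolding lattice_edges_def by fastforce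
  qed (use Suc.prems(2)[of "j + int n"] Suc.prems(2)[of "j + int (Suc n)"] in auto)
  ultimately have "realizable E (k + 2 * n + 2) (Transposition.transpose u (i, j + int (Suc n)))"
    by (rule realizable_transpose_extend)
  then show ?case by simp
qed

text \<open>
  The two columns share some row \<open>k\<close>. As both are intervals, they also share a row \<open>l\<close> between \<open>j\<close> and \<open>j'\<close>. So
  one can climb in the first column to \<open>l\<close>, cross, and climb on in the second column: at most three edges, hence
  six rounds, without leaving the heights from \<open>j\<close> to \<open>j'\<close>.
\<close>

lemma realizable_diagonal_transpose:
  fixes L :: "(int \<times> int) set"
  assumes conv: "\<And>i j k l. (i, j) \<in> L \<Longrightarrow> (i, k) \<in> L \<Longrightarrow> j \<le> l \<Longrightarrow> l \<le> k \<Longrightarrow> (i, l) \<in> L"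
    and uv: "(i, j) \<in> L" "(i', j') \<in> L" "\<bar>i - i'\<bar> = 1" "j \<le> j'" "j' \<le> j + 2"
    and cross: "(i, k) \<in> L" "(i', k) \<in> L"
    and X: "\<And>l. j \<le> l \<Longrightarrow> l \<le> j' \<Longrightarrow> (i, l) \<in> X \<and> (i', l) \<in> X"
  shows "realizable {e \<in> lattice_edges L. e \<subseteq> X} 6 (Transposition.transpose (i, j) (i', j'))"
proof -
  let ?E = "{e \<in> lattice_edges L. e \<subseteq> X}"
  obtain l where l: "j \<le> l" "l \<le> j'" "(i, l) \<in> L" "(i', l) \<in> L"
  proof -
    consider "k < j" | "j' < k" | "j \<le> k" "k \<le> j'" by linarith
    then show thesis
    proof cases
      case 1
      then show ?thesis using that[of j] conv[OF cross(2) uv(2), of j] uv by simp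
    next
      case 2
      then show ?thesis using that[of j'] conv[OF uv(1) cross(1), of j'] uv by simp
    qed (use that[of k] cross in auto)
  qed
  obtain m n where mn: "l = j + int m" "j' = l + int n"
    using l(1,2) by (metis le_iff_diff_le_0 zle_iff_zadd)
  have 1: "realizable ?E (0 + 2 * m) (Transposition.transpose (i, j) (i, j + int m))"
  proof (rule realizable_climb)
    show "realizable ?E 0 (Transposition.transpose (i, j) (i, j))" by simp
    show "(i, h) \<in> L" if "j \<le> h" "h \<le> j + int m" for h
      using conv[OF uv(1) l(3)] that mn by simp
    show "(i, h) \<in> X" if "j \<le> h" "h \<le> j + int m" for h
      using X[of h] that mn by simp
  qed simp
  have "{(i, l), (i', l)} \<in> ?E"
    using l X[of l] uv(3) unfolding lattice_edges_def by fastforce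
  with 1 have 2: "realizable ?E (0 + 2 * m + 2) (Transposition.transpose (i, j) (i', l))"
    unfolding mn(1)[symmetric] by (rule realizable_transpose_extend)
  have 3: "realizable ?E (0 + 2 * m + 2 + 2 * n) (Transposition.transpose (i, j) (i', l + int n))"
  proof (rule realizable_climb[OF 2])
    show "(i', h) \<in> L" if "l \<le> h" "h \<le> l + int n" for h
      using conv[OF l(4) uv(2)] that mn by simp
    show "(i', h) \<in> X" if "l \<le> h" "h \<le> l + int n" for h
      using X[of h] that mn by simp
  qed simp
  have "0 + 2 * m + 2 + 2 * n \<le> 6" using mn uv(5) by linarith
  then show ?thesis using 3 unfolding mn(2)[symmetric] by (rule realizable_mono[rotated])
qed

text \<open>
  The swap between the columns \<open>i\<close> and \<open>i + 1\<close> at height \<open>y\<close> above the spine takes place in a box of two columns and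
  at most three rows. The boxes of two swaps can only meet if the columns are close or the heights differ by less than
  three. So \<open>i mod 2\<close> and \<open>y mod 3\<close> together are a suitable colouring with six colours.
\<close>

lemma sheared_swap_round_realizable:
  fixes L :: "(int \<times> int) set"
  assumes conv: "\<And>i j k l. (i, j) \<in> L \<Longrightarrow> (i, k) \<in> L \<Longrightarrow> j \<le> l \<Longrightarrow> l \<le> k \<Longrightarrow> (i, l) \<in> L"
    and cross: "\<And>i j j'. (i, j) \<in> L \<Longrightarrow> (i + 1, j') \<in> L \<Longrightarrow> \<exists>k. (i, k) \<in> L \<and> (i + 1, k) \<in> L"
    and c: "\<And>i j j'. (i, j) \<in> L \<Longrightarrow> (i + 1, j') \<in> L \<Longrightarrow> \<bar>c (i + 1) - c i\<bar> \<le> 2"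
    and q: "swap_round (sheared_edges L c) q"
  shows "realizable (lattice_edges L) 36 q"
proof -
  define lo where "lo = (\<lambda>v. min (fst v) (fst (q v)))"
  define \<kappa> where "\<kappa> = (\<lambda>v. nat (3 * (lo v mod 2) + (snd v - c (fst v)) mod 3))"
  define N where "N = (\<lambda>v. {lo v..lo v + 1} \<times> {min (snd v) (snd (q v))..max (snd v) (snd (q v))})"
  have invol: "q (q v) = v" for v using q unfolding swap_round_def by (metis comp_apply id_apply)
  have moved: "\<exists>i y. (i, c i + y) \<in> L \<and> (i + 1, c (i + 1) + y) \<in> L \<and>
      (v = (i, c i + y) \<and> q v = (i + 1, c (i + 1) + y) \<or> q v = (i, c i + y) \<and> v = (i + 1, c (i + 1) + y))"
    if "q v \<noteq> v" for v
  proof -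
    have "{v, q v} \<in> sheared_edges L c" using q that unfolding swap_round_def by blast
    then show ?thesis unfolding sheared_edges_def by (auto simp: doubleton_eq_iff)
  qed
  have "realizable (lattice_edges L) (6 * 6) q"
  proof (rule realizable_simulate[where \<kappa> = \<kappa> and N = N, OF invol])
    fix v
    have "0 \<le> 3 * (lo v mod 2) + (snd v - c (fst v)) mod 3"
      "3 * (lo v mod 2) + (snd v - c (fst v)) mod 3 < 6" by presburger+
    then show "\<kappa> v < 6" unfolding \<kappa>_def by linarith
    show "\<kappa> (q v) = \<kappa> v"
    proof (cases "q v = v")
      case False
      then have "snd (q v) - c (fst (q v)) = snd v - c (fst v)" using moved[OF False] by force
      then show ?thesis unfolding \<kappa>_def lo_def by (simp add: invol min.commute)
    qed simp
    show "N (q v) = N v" unfolding N_def lo_def by (simp add: invol min.commute max.commute)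
  next
    fix v assume "q v \<noteq> v"
    then show "v \<in> N v" using moved[of v] unfolding N_def lo_def by (cases v) auto
  next
    fix v w assume vw: "q v \<noteq> v" "q w \<noteq> w" "\<kappa> v = \<kappa> w" "w \<noteq> v" "w \<noteq> q v"
    obtain i y where v: "(i, c i + y) \<in> L" "(i + 1, c (i + 1) + y) \<in> L"
      "v = (i, c i + y) \<and> q v = (i + 1, c (i + 1) + y) \<or> q v = (i, c i + y) \<and> v = (i + 1, c (i + 1) + y)"
      using moved[OF vw(1)] by blast
    obtain i' y' where w: "w = (i', c i' + y') \<and> q w = (i' + 1, c (i' + 1) + y')
        \<or> q w = (i', c i' + y') \<and> w = (i' + 1, c (i' + 1) + y')"
      using moved[OF vw(2)] by blast
    have lo: "lo v = i" "lo w = i'" "snd v - c (fst v) = y" "snd w - c (fst w) = y'"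
      using v(3) w unfolding lo_def by auto
    have code: "3 * (i mod 2) + y mod 3 = 3 * (i' mod 2) + y' mod 3"
    proof -
      have "0 \<le> 3 * (i mod 2) + y mod 3" "0 \<le> 3 * (i' mod 2) + y' mod 3" by simp_all
      then show ?thesis using vw(3) unfolding \<kappa>_def lo by (simp add: eq_nat_nat_iff)
    qed
    have digits: "a = a' \<and> b = b'"
      if "3 * a + b = 3 * a' + b'" "0 \<le> b" "b < 3" "0 \<le> b'" "b' < 3" for a a' b b' :: int
      using that by presburger
    have "i mod 2 = i' mod 2 \<and> y mod 3 = y' mod 3"
      by (rule digits[OF code]) simp_all
    then have mods: "i mod 2 = i' mod 2" "y mod 3 = y' mod 3" by blast+
    have Nv: "N v = {i..i + 1} \<times> {min (c i) (c (i + 1)) + y..max (c i) (c (i + 1)) + y}"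
      using v(3) unfolding N_def lo by auto
    have Nw: "N w = {i'..i' + 1} \<times> {min (c i') (c (i' + 1)) + y'..max (c i') (c (i' + 1)) + y'}"
      using w unfolding N_def lo by auto
    show "N v \<inter> N w = {}"
    proof (cases "i = i'")
      case False
      then have "i + 1 < i' \<or> i' + 1 < i" using mods(1) by presburger
      then show ?thesis unfolding Nv Nw by auto
    next
      case True
      have "y \<noteq> y'"
      proof
        assume "y = y'"
        then have "w = v \<or> w = q v" using v(3) w True by auto
        then show False using vw(4,5) by blast
      qed
      then have "y + 2 < y' \<or> y' + 2 < y" using mods(2) by presburger
      then show ?thesis using c[OF v(1,2)] unfolding Nv Nw True by auto
    qed
  next
    fix v assume qv: "q v \<noteq> v"
    obtain i y where v: "(i, c i + y) \<in> L" "(i + 1, c (i + 1) + y) \<in> L"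
      "v = (i, c i + y) \<and> q v = (i + 1, c (i + 1) + y) \<or> q v = (i, c i + y) \<and> v = (i + 1, c (i + 1) + y)"
      using moved[OF qv] by blast
    obtain k where k: "(i, k) \<in> L" "(i + 1, k) \<in> L" using cross[OF v(1,2)] by blast
    have Nv: "N v = {i..i + 1} \<times> {min (c i + y) (c (i + 1) + y)..max (c i + y) (c (i + 1) + y)}"
      using v(3) unfolding N_def lo_def by auto
    have c2: "\<bar>c (i + 1) - c i\<bar> \<le> 2" using c[OF v(1,2)] .
    have "Transposition.transpose v (q v) = Transposition.transpose (i, c i + y) (i + 1, c (i + 1) + y)"
      using v(3) transpose_commute by metis
    moreover have "realizable {e \<in> lattice_edges L. e \<subseteq> N v} 6
      (Transposition.transpose (i, c i + y) (i + 1, c (i + 1) + y))"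
    proof (cases "c i \<le> c (i + 1)")
      case True
      show ?thesis
        by (rule realizable_diagonal_transpose[OF conv v(1,2) _ _ _ k]) (use True c2 Nv in auto)
    next
      case False
      have "realizable {e \<in> lattice_edges L. e \<subseteq> N v} 6
        (Transposition.transpose (i + 1, c (i + 1) + y) (i, c i + y))"
        by (rule realizable_diagonal_transpose[OF conv v(2,1) _ _ _ k(2,1)]) (use False c2 Nv in auto)
      then show ?thesis by (simp only: transpose_commute)
    qed
    ultimately show "realizable {e \<in> lattice_edges L. e \<subseteq> N v} 6 (Transposition.transpose v (q v))" by simp
  qed
  then show ?thesis by simp
qed

lemma sheared_realizable:
  fixes L :: "(int \<times> int) set"
  assumes conv: "\<And>i j k l. (i, j) \<in> L \<Longrightarrow> (i, k) \<in> L \<Longrightarrow> j \<le> l \<Longrightarrow> l \<le> k \<Longrightarrow> (i, l) \<in> L"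
    and cross: "\<And>i j j'. (i, j) \<in> L \<Longrightarrow> (i + 1, j') \<in> L \<Longrightarrow> \<exists>k. (i, k) \<in> L \<and> (i + 1, k) \<in> L"
    and c: "\<And>i j j'. (i, j) \<in> L \<Longrightarrow> (i + 1, j') \<in> L \<Longrightarrow> \<bar>c (i + 1) - c i\<bar> \<le> 2"
    and p: "realizable (sheared_edges L c) k p"
  shows "realizable (lattice_edges L) (36 * k) p"
  using p
proof (induction k arbitrary: p)
  case (Suc k)
  then obtain r p' where r: "swap_round (sheared_edges L c) r"
    and p': "realizable (sheared_edges L c) k p'" and p: "p = r \<circ> p'" by auto
  have "realizable (lattice_edges L) (36 + 36 * k) (r \<circ> p')"
    by (rule realizable_comp[OF sheared_swap_round_realizable[OF conv cross c r] Suc.IH[OF p']])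
  then show ?case unfolding p mult_Suc_right .
qed simp

section \<open>Lattice points of convex sets\<close>

lemma convex_taper:
  fixes D :: "(real \<times> real) set"
  assumes "convex D" "(a, 0) \<in> D" "(b, h) \<in> D" "0 \<le> t" "t \<le> 1"
  shows "((1 - t) * a + t * b, t * h) \<in> D"
  using convexD_alt[OF assms] by simp

lemma convex_vertical:
  fixes D :: "(real \<times> real) set"
  assumes D: "convex D" "(x, a) \<in> D" "(x, b) \<in> D" and t: "a \<le> t" "t \<le> b"
  shows "(x, t) \<in> D"
proof (cases "a = b")
  case False
  define s where "s = (t - a) / (b - a)"
  have "0 \<le> s" "s \<le> 1" using t False by (auto simp: s_def divide_simps)
  then have "(1 - s) *\<^sub>R (x, a) + s *\<^sub>R (x, b) \<in> D" by (rule convexD_alt[OF D])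
  moreover have "(1 - s) * x + s * x = x" by (simp add: algebra_simps)
  moreover have "(1 - s) * a + s * b = a + s * (b - a)" by (simp add: algebra_simps)
  moreover have "s * (b - a) = t - a" using False by (simp add: s_def)
  ultimately show ?thesis by simp
qed (use assms in auto)

lemma convex_horizontal:
  fixes D :: "(real \<times> real) set"
  assumes D: "convex D" "(a, y) \<in> D" "(b, y) \<in> D" and t: "a \<le> t" "t \<le> b"
  shows "(t, y) \<in> D"
proof -
  have "convex (prod.swap ` D)"
    using D(1) by (intro convex_linear_image) (auto simp: linear_iff)
  then have "(y, t) \<in> prod.swap ` D"
    by (rule convex_vertical[where a = a and b = b]) (use D t in \<open>force+\<close>)
  then show ?thesis by auto
qed

lemma int_interval_enum:
  fixes S :: "int set"
  assumes conv: "\<And>j k l. j \<in> S \<Longrightarrow> k \<in> S \<Longrightarrow> j \<le> l \<Longrightarrow> l \<le> k \<Longrightarrow> l \<in> S"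
    and diam: "\<And>j k. j \<in> S \<Longrightarrow> k \<in> S \<Longrightarrow> k - j < int N"
  shows "\<exists>lo n. n \<le> N \<and> S = {lo..<lo + int n}"
proof (cases "S = {}")
  case True
  then show ?thesis by (intro exI[of _ 0]) simp
next
  case False
  then obtain s where s: "s \<in> S" by blast
  have "S \<subseteq> {s - int N..s + int N}" using diam[OF s] diam[OF _ s] by force
  then have fin: "finite S" by (rule finite_subset) simp
  let ?n = "nat (Max S - Min S + 1)"
  have mm: "Min S \<in> S" "Max S \<in> S" using fin False by simp_all
  have "S = {Min S..<Min S + int ?n}"
  proof (intro equalityI subsetI)
    fix x assume "x \<in> S"
    then have "Min S \<le> x" "x \<le> Max S" using fin by simp_all
    then show "x \<in> {Min S..<Min S + int ?n}" by simp
  next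
    fix x assume "x \<in> {Min S..<Min S + int ?n}"
    moreover have "Min S \<le> Max S" using fin mm by simp
    ultimately show "x \<in> S" by (intro conv[OF mm]) auto
  qed
  moreover have "?n \<le> N" using diam[OF mm] by linarith
  ultimately show ?thesis by blast
qed

lemma columns_routable:
  fixes L :: "(int \<times> int) set"
  assumes conv: "\<And>i j k l. (i, j) \<in> L \<Longrightarrow> (i, k) \<in> L \<Longrightarrow> j \<le> l \<Longrightarrow> l \<le> k \<Longrightarrow> (i, l) \<in> L"
    and diam: "\<And>i j k. (i, j) \<in> L \<Longrightarrow> (i, k) \<in> L \<Longrightarrow> k - j < int N"
  shows "fibre_routable (lattice_edges L) L fst (2 * N)"
proof (rule fibre_routable_paths)
  fix x
  have "\<exists>lo n. n \<le> N \<and> {j. (x, j) \<in> L} = {lo..<lo + int n}"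
    by (rule int_interval_enum; unfold mem_Collect_eq) (fact conv, fact diam)
  then obtain lo n where S: "n \<le> N" "{j. (x, j) \<in> L} = {lo..<lo + int n}" by blast
  have mem: "(x, j) \<in> L \<longleftrightarrow> lo \<le> j \<and> j < lo + int n" for j
    using eqset_imp_iff[OF S(2), of j] by simp
  let ?e = "\<lambda>k. (x, lo + int k)"
  have "?e ` {..<n} = {v \<in> L. fst v = x}"
  proof (intro equalityI subsetI)
    fix v assume "v \<in> {v \<in> L. fst v = x}"
    then obtain j where j: "v = (x, j)" "(x, j) \<in> L" by (cases v) auto
    then have "?e (nat (j - lo)) = v" "nat (j - lo) \<in> {..<n}" using mem[of j] by auto
    then show "v \<in> ?e ` {..<n}" by (rule image_eqI[OF sym])
  next
    fix v assume "v \<in> ?e ` {..<n}"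
    then obtain k where "k < n" "v = ?e k" by blast
    then show "v \<in> {v \<in> L. fst v = x}" using mem[of "lo + int k"] by simp
  qed
  moreover have "{?e k, ?e (Suc k)} \<in> lattice_edges L" if "Suc k < n" for k
    using mem[of "lo + int k"] mem[of "lo + int (Suc k)"] that
    unfolding lattice_edges_def by fastforce
  ultimately show "\<exists>e n. n \<le> N \<and> inj_on e {..<n} \<and> e ` {..<n} = {v \<in> L. fst v = x}
      \<and> (\<forall>k. Suc k < n \<longrightarrow> {e k, e (Suc k)} \<in> lattice_edges L)"
    using S(1) by (intro exI[of _ ?e] exI[of _ n]) (simp add: inj_on_def)
qed

text \<open>
  A sheared row without gaps is a path of the sheared graph, where it is sorted in \<open>2 N\<close> rounds; each of them costs
  \<open>36\<close> rounds of the lattice.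
\<close>

lemma sheared_rows_routable:
  fixes L :: "(int \<times> int) set"
  assumes conv: "\<And>i j k l. (i, j) \<in> L \<Longrightarrow> (i, k) \<in> L \<Longrightarrow> j \<le> l \<Longrightarrow> l \<le> k \<Longrightarrow> (i, l) \<in> L"
    and cross: "\<And>i j j'. (i, j) \<in> L \<Longrightarrow> (i + 1, j') \<in> L \<Longrightarrow> \<exists>k. (i, k) \<in> L \<and> (i + 1, k) \<in> L"
    and c: "\<And>i j j'. (i, j) \<in> L \<Longrightarrow> (i + 1, j') \<in> L \<Longrightarrow> \<bar>c (i + 1) - c i\<bar> \<le> 2"
    and A: "A \<subseteq> L"
    and rows: "\<And>i j k y. (i, c i + y) \<in> A \<Longrightarrow> (k, c k + y) \<in> A \<Longrightarrow> i \<le> j \<Longrightarrow> j \<le> k \<Longrightarrow> (j, c j + y) \<in> A"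
    and diam: "\<And>v w. v \<in> A \<Longrightarrow> w \<in> A \<Longrightarrow> fst w - fst v < int N"
  shows "fibre_routable (lattice_edges L) A (\<lambda>v. snd v - c (fst v)) (72 * N)"
proof -
  have "fibre_routable (sheared_edges L c) A (\<lambda>v. snd v - c (fst v)) (2 * N)"
  proof (rule fibre_routable_paths)
    fix y
    have "\<exists>lo n. n \<le> N \<and> {i. (i, c i + y) \<in> A} = {lo..<lo + int n}"
    proof (rule int_interval_enum; unfold mem_Collect_eq)
      show "k - j < int N" if "(j, c j + y) \<in> A" "(k, c k + y) \<in> A" for j k
        using diam[OF that] by simp
    qed (fact rows)
    then obtain lo n where S: "n \<le> N" "{i. (i, c i + y) \<in> A} = {lo..<lo + int n}" by blast
    have mem: "(i, c i + y) \<in> A \<longleftrightarrow> lo \<le> i \<and> i < lo + int n" for i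
      using eqset_imp_iff[OF S(2), of i] by simp
    let ?e = "\<lambda>k. (lo + int k, c (lo + int k) + y)"
    have "?e ` {..<n} = {v \<in> A. snd v - c (fst v) = y}"
    proof (intro equalityI subsetI)
      fix v assume "v \<in> {v \<in> A. snd v - c (fst v) = y}"
      then obtain i where i: "v = (i, c i + y)" "(i, c i + y) \<in> A" by (cases v) auto
      then have "?e (nat (i - lo)) = v" "nat (i - lo) \<in> {..<n}" using mem[of i] by auto
      then show "v \<in> ?e ` {..<n}" by (rule image_eqI[OF sym])
    next
      fix v assume "v \<in> ?e ` {..<n}"
      then obtain k where "k < n" "v = ?e k" by blast
      then show "v \<in> {v \<in> A. snd v - c (fst v) = y}" using mem[of "lo + int k"] by simp
    qed
    moreover have "{?e k, ?e (Suc k)} \<in> sheared_edges L c" if "Suc k < n" for k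
    proof -
      have "(lo + int k, c (lo + int k) + y) \<in> L" "(lo + int k + 1, c (lo + int k + 1) + y) \<in> L"
        using A mem[of "lo + int k"] mem[of "lo + int k + 1"] that by auto
      moreover have "lo + int (Suc k) = lo + int k + 1" by simp
      ultimately show ?thesis unfolding sheared_edges_def by (simp only:) blast
    qed
    ultimately show "\<exists>e n. n \<le> N \<and> inj_on e {..<n} \<and> e ` {..<n} = {v \<in> A. snd v - c (fst v) = y}
        \<and> (\<forall>k. Suc k < n \<longrightarrow> {e k, e (Suc k)} \<in> sheared_edges L c)"
      using S(1) by (intro exI[of _ ?e] exI[of _ n]) (simp add: inj_on_def)
  qed
  then show ?thesis
    using sheared_realizable[where L = L and c = c and k = "2 * N", OF conv cross c] unfolding fibre_routable_def by simp
qed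

text \<open>
  The upper half of a convex set \<open>D\<close> that contains the axis from \<open>a\<close> to \<open>b\<close>, seen at the lattice points shifted by the
  rounding errors \<open>off\<close>. The set tapers at most linearly from its highest lattice point, of height \<open>U\<close>, to the two
  ends of the axis, so it reaches height about \<open>U / 8\<close> over the whole middle half; \<open>d\<close> is this height minus the
  rounding. (The middle half starts at a rounded quarter, hence \<open>1 / 8\<close> in place of \<open>1 / 4\<close>.) The condition
  \<open>(i, y + 1) \<in> D\<close> is a condition on \<open>D\<close> itself, without rounding errors: it implies that the shifted lattice point at height \<open>y\<close>
  is in \<open>D\<close>, and by convexity it holds for an interval of columns \<open>i\<close>. The last claim says that replacing lattice points by
  this condition and cutting at height \<open>d\<close> retains a constant fraction of each column.
\<close>

lemma mountain_arm:
  fixes D :: "(real \<times> real) set" and a b :: int and off :: "int \<Rightarrow> real"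
  assumes D: "convex D" "(real_of_int a, 0) \<in> D" "(real_of_int b, 0) \<in> D" and ab: "a < b"
    and off: "\<And>i. a \<le> i \<Longrightarrow> i \<le> b \<Longrightarrow> \<bar>off i\<bar> \<le> 1"
    and bound: "\<And>i y. a \<le> i \<Longrightarrow> i \<le> b \<Longrightarrow> (real_of_int i, real_of_int y + off i) \<in> D \<Longrightarrow> y \<le> b - a"
  shows "\<exists>d\<ge>0. (\<forall>i\<in>{a + (b - a) div 4..a + 3 * (b - a) div 4}. \<forall>y. 0 < y \<and> y \<le> d \<longrightarrow>
        (real_of_int i, real_of_int y + 1) \<in> D)
    \<and> (\<forall>i\<in>{a..b}. card {y. 0 < y \<and> (real_of_int i, real_of_int y + off i) \<in> D}
        \<le> 25 * (card {y. 0 < y \<and> y \<le> d \<and> (real_of_int i, real_of_int y + 1) \<in> D} + 1))"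
proof -
  have axis: "(real_of_int i, 0) \<in> D" if "a \<le> i" "i \<le> b" for i
    by (rule convex_horizontal[OF D]) (use that in auto)
  define S where "S = {y. 0 \<le> y \<and> (\<exists>i. a \<le> i \<and> i \<le> b \<and> (real_of_int i, real_of_int y + off i) \<in> D)}"
  have "S \<subseteq> {0..b - a}" unfolding S_def using bound by auto
  then have finS: "finite (insert 0 S)" using finite_subset by blast
  define U where "U = Max (insert 0 S)"
  have U0: "0 \<le> U" unfolding U_def using finS by (intro Max_ge) auto
  have U: "y \<le> U" if "a \<le> i" "i \<le> b" "(real_of_int i, real_of_int y + off i) \<in> D" for i y
  proof (cases "0 \<le> y")
    case True
    then have "y \<in> insert 0 S" unfolding S_def using that by blast
    then show ?thesis unfolding U_def by (rule Max_ge[OF finS])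
  qed (use U0 in simp)
  \<comment> \<open>The subtraction of \<open>1\<close> pays for the rounding. For small \<open>U\<close> only the axis is used.\<close>
  define d where "d = max 0 ((U - 1) div 8 - 1)"
  have d0: "0 \<le> d" unfolding d_def by simp
  have "(U - 1) div 8 - 1 \<le> d" unfolding d_def by simp
  moreover have "U - 1 < 8 * ((U - 1) div 8) + 8" by presburger
  ultimately have Ud: "U \<le> 8 * d + 16" by linarith
  have low: "(real_of_int i, real_of_int y + 1) \<in> D"
    if i: "i \<in> {a + (b - a) div 4..a + 3 * (b - a) div 4}" and y: "0 < y" "y \<le> d" for i y
  proof -
    have "y \<le> (U - 1) div 8 - 1" using y unfolding d_def by (simp add: le_max_iff_disj)
    moreover have "8 * ((U - 1) div 8) \<le> U - 1" by presburger
    ultimately have dU: "8 * y + 8 \<le> U - 1" by simp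
    then have "U \<noteq> 0" using y by linarith
    then have "U \<in> S" using Max_in[OF finS] unfolding U_def by blast
    then obtain x where x: "a \<le> x" "x \<le> b" "(real_of_int x, real_of_int U + off x) \<in> D"
      unfolding S_def by blast
    have Uab: "U \<le> b - a" by (rule bound[OF x])
    have top: "(real_of_int x, real_of_int (U - 1)) \<in> D"
      by (rule convex_vertical[OF D(1) axis[OF x(1,2)] x(3)])
        (use dU y(1) off[OF x(1,2)] in \<open>auto simp: abs_le_iff\<close>)
    have ba: "16 \<le> b - a" using dU y(1) Uab by linarith
    have i_left: "b - a \<le> 8 * (i - a)" using i ba by auto
    have i_right: "b - a \<le> 8 * (b - i)"
    proof -
      define z where "z = 3 * (b - a) div 4"
      have "4 * z \<le> 3 * b - 3 * a" unfolding z_def by presburger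
      moreover have "i \<le> a + z" using i unfolding z_def by simp
      ultimately show ?thesis using ab by simp
    qed
    have iab: "a < i" "i < b" using i_left i_right ba by auto
    have "\<exists>t\<ge>1/8. (real_of_int i, t * real_of_int (U - 1)) \<in> D"
    proof (cases "i \<le> x")
      case True
      define t where "t = real_of_int (i - a) / real_of_int (x - a)"
      have pos: "0 < real_of_int (x - a)" using iab True by linarith
      have t01: "0 \<le> t" "t \<le> 1" using pos iab True by (auto simp: t_def divide_simps)
      have "real_of_int (x - a) \<le> 8 * real_of_int (i - a)" using i_left x(2) by linarith
      then have t8: "1 / 8 \<le> t" using pos unfolding t_def by (simp add: divide_simps)
      have "t * real_of_int (x - a) = real_of_int (i - a)" using pos unfolding t_def by simp
      then have "(1 - t) * real_of_int a + t * real_of_int x = real_of_int i" by (simp add: algebra_simps)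
      then show ?thesis using convex_taper[OF D(1,2) top t01] t8 by auto
    next
      case False
      define t where "t = real_of_int (b - i) / real_of_int (b - x)"
      have pos: "0 < real_of_int (b - x)" using iab False by linarith
      have t01: "0 \<le> t" "t \<le> 1" using pos iab False by (auto simp: t_def divide_simps)
      have "real_of_int (b - x) \<le> 8 * real_of_int (b - i)" using i_right x(1) by linarith
      then have t8: "1 / 8 \<le> t" using pos unfolding t_def by (simp add: divide_simps)
      have "t * real_of_int (b - x) = real_of_int (b - i)" using pos unfolding t_def by simp
      then have "(1 - t) * real_of_int b + t * real_of_int x = real_of_int i" by (simp add: algebra_simps)
      then show ?thesis using convex_taper[OF D(1,3) top t01] t8 by auto
    qed
    then obtain t where t: "1/8 \<le> t" "(real_of_int i, t * real_of_int (U - 1)) \<in> D" by blast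
    have "real_of_int (8 * y + 8) \<le> real_of_int (U - 1)" using dU by (rule of_int_le_iff[THEN iffD2])
    then have "real_of_int y + 1 \<le> 1/8 * real_of_int (U - 1)" by simp
    also have "\<dots> \<le> t * real_of_int (U - 1)" using t(1) dU y(1) by (intro mult_right_mono) auto
    finally show ?thesis
      using y(1) iab by (intro convex_vertical[OF D(1) axis t(2)]) auto
  qed
  have count: "card {y. 0 < y \<and> (real_of_int i, real_of_int y + off i) \<in> D}
        \<le> 25 * (card {y. 0 < y \<and> y \<le> d \<and> (real_of_int i, real_of_int y + 1) \<in> D} + 1)"
    if i: "a \<le> i" "i \<le> b" for i
  proof -
    let ?Y = "{y. 0 < y \<and> (real_of_int i, real_of_int y + off i) \<in> D}"
    let ?T = "{y. 0 < y \<and> y \<le> d \<and> (real_of_int i, real_of_int y + 1) \<in> D}"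
    have sub: "?Y \<subseteq> {0<..U}" using U[OF i] by auto
    then have finY: "finite ?Y" by (rule finite_subset) simp
    show ?thesis
    proof (cases "?Y = {}")
      case False
      define u where "u = Max ?Y"
      have u: "u \<in> ?Y" unfolding u_def by (rule Max_in[OF finY False])
      have "?Y \<subseteq> {0<..u}" unfolding u_def using finY by auto
      then have "card ?Y \<le> card {0<..u}" by (intro card_mono) auto
      then have Yu: "card ?Y \<le> nat u" by simp
      \<comment> \<open>Two units below the top of the column, rounding errors do not matter.\<close>
      have "{0<..min d (u - 2)} \<subseteq> ?T"
      proof
        fix y assume y: "y \<in> {0<..min d (u - 2)}"
        have below: "real_of_int y + 1 \<le> real_of_int u + off i"
          using y off[OF i] by (simp add: abs_le_iff)
        have "(real_of_int i, real_of_int u + off i) \<in> D" using u by simp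
        moreover have "0 \<le> real_of_int y + 1" using y by simp
        ultimately have "(real_of_int i, real_of_int y + 1) \<in> D"
          using below by (rule convex_vertical[OF D(1) axis[OF i]])
        then show "y \<in> ?T" using y by simp
      qed
      moreover have "finite ?T" by (rule finite_subset[of _ "{0<..d}"]) auto
      ultimately have "card {0<..min d (u - 2)} \<le> card ?T" by (rule card_mono[rotated])
      then have "nat (min d (u - 2)) \<le> card ?T" by simp
      moreover have "u \<le> 25 * (min d (u - 2)) + 25 \<or> u \<le> 2"
        using U[OF i, of u] u Ud d0 by (auto simp: min_def)
      ultimately show ?thesis using Yu d0 by (auto simp: min_def split: if_splits)
    next
      case True
      show ?thesis unfolding True by simp
    qed
  qed
  show ?thesis using d0 low count by (intro exI[of _ d]) auto
qed

section \<open>The fat rectangle in a convex lattice set\<close>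

lemma fibre_routable_mono:
  assumes "fibre_routable E A f k" "B \<subseteq> A" "k \<le> l"
  shows "fibre_routable E B f l"
  using assms permutes_subset realizable_mono unfolding fibre_routable_def by metis

text \<open>
  If a column contains some lattice point, then one of the two lattice points next to any given height of the
  column belongs to it, since it lies in between.
\<close>

lemma lattice_point_near:
  fixes Q :: "(real \<times> real) set"
  assumes Q: "convex Q" "(x, \<mu>) \<in> Q" "(x, real_of_int j) \<in> Q"
  shows "\<exists>l. (x, real_of_int l) \<in> Q \<and> \<bar>real_of_int l - \<mu>\<bar> < 1"
proof (cases "\<mu> \<le> real_of_int j")
  case True
  have "(x, real_of_int \<lceil>\<mu>\<rceil>) \<in> Q"
    by (rule convex_vertical[OF Q]) (use True in \<open>simp_all add: ceiling_le_iff\<close>)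
  then show ?thesis by (intro exI[of _ "\<lceil>\<mu>\<rceil>"]) linarith
next
  case False
  have "(x, real_of_int \<lfloor>\<mu>\<rfloor>) \<in> Q"
    by (rule convex_vertical[OF Q(1,3,2)]) (use False in \<open>simp_all add: le_floor_iff\<close>)
  then show ?thesis by (intro exI[of _ "\<lfloor>\<mu>\<rfloor>"]) linarith
qed

lemma convex_shear:
  fixes Q :: "(real \<times> real) set" and \<epsilon> \<alpha> s :: real
  assumes "convex Q"
  shows "convex {p. (fst p, \<alpha> + s * fst p + \<epsilon> * snd p) \<in> Q}"
proof (rule convexI)
  fix p q :: "real \<times> real" and u v :: real
  assume pq: "p \<in> {p. (fst p, \<alpha> + s * fst p + \<epsilon> * snd p) \<in> Q}" "q \<in> {p. (fst p, \<alpha> + s * fst p + \<epsilon> * snd p) \<in> Q}"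
    and uv: "0 \<le> u" "0 \<le> v" "u + v = 1"
  have "u *\<^sub>R (fst p, \<alpha> + s * fst p + \<epsilon> * snd p) + v *\<^sub>R (fst q, \<alpha> + s * fst q + \<epsilon> * snd q) \<in> Q"
    by (rule convexD[OF assms _ _ uv]) (use pq in simp_all)
  moreover have "u * (\<alpha> + s * fst p + \<epsilon> * snd p) + v * (\<alpha> + s * fst q + \<epsilon> * snd q)
      = \<alpha> + s * (u * fst p + v * fst q) + \<epsilon> * (u * snd p + v * snd q)"
  proof -
    have v: "v = 1 - u" using uv(3) by simp
    show ?thesis unfolding v by (simp add: algebra_simps)
  qed
  ultimately show "u *\<^sub>R p + v *\<^sub>R q \<in> {p. (fst p, \<alpha> + s * fst p + \<epsilon> * snd p) \<in> Q}" by simp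
qed

text \<open>
  Here the pieces come together for a convex lattice set that is at least as wide as high. The constant collects
  \<open>3 t\<close> rounds for the rectangle with \<open>t = 72 * N\<close>, one doubling along the rows, \<open>3 (3 t + 2 t) = 15 t\<close>, and six doublings
  along the columns, \<open>3 ^ 6 (15 t + 2 t)\<close>.
\<close>

theorem lattice_routable:
  fixes Q :: "(real \<times> real) set" and L :: "(int \<times> int) set" and a b :: int
  assumes Q: "convex Q" and L: "\<And>i j. (i, j) \<in> L \<longleftrightarrow> (real_of_int i, real_of_int j) \<in> Q"
    and ends: "(a, \<alpha>) \<in> L" "(b, \<beta>) \<in> L" and ab: "a < b"
    and width: "\<And>i j. (i, j) \<in> L \<Longrightarrow> a \<le> i \<and> i \<le> b"
    and height: "\<And>i j k l. (i, j) \<in> L \<Longrightarrow> (k, l) \<in> L \<Longrightarrow> l - j \<le> b - a"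
    and cross: "\<And>i. a \<le> i \<Longrightarrow> i < b \<Longrightarrow> \<exists>k. (i, k) \<in> L \<and> (i + 1, k) \<in> L"
  shows "routable (lattice_edges L) L (3 ^ 6 * 17 * 72 * nat (b - a + 1))"
proof -
  define N where "N = nat (b - a + 1)"
  have intN: "int N = b - a + 1" unfolding N_def using ab by simp
  define s where "s = real_of_int (\<beta> - \<alpha>) / real_of_int (b - a)"
  define m where "m = (\<lambda>x. (real_of_int \<alpha> - s * real_of_int a) + s * x)"
  define D where "D = (\<lambda>\<epsilon>. {p. (fst p, (real_of_int \<alpha> - s * real_of_int a) + s * fst p + \<epsilon> * snd p) \<in> Q})"
  have D: "(x, r) \<in> D \<epsilon> \<longleftrightarrow> (x, m x + \<epsilon> * r) \<in> Q" for x r \<epsilon>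
    unfolding D_def m_def by simp
  have convD: "convex (D \<epsilon>)" for \<epsilon> unfolding D_def by (rule convex_shear[OF Q])
  have pos: "0 < real_of_int (b - a)" using ab by simp
  have s_eq: "s * real_of_int (b - a) = real_of_int (\<beta> - \<alpha>)" unfolding s_def using pos by simp
  have ma: "m (real_of_int a) = real_of_int \<alpha>" unfolding m_def by simp
  have mb: "m (real_of_int b) = real_of_int \<beta>" using s_eq unfolding m_def by (simp add: algebra_simps)
  have s1: "\<bar>s\<bar> \<le> 1"
  proof -
    have "\<bar>\<beta> - \<alpha>\<bar> \<le> b - a" using height[OF ends] height[OF ends(2,1)] by (simp add: abs_le_iff)
    then have "\<bar>real_of_int (\<beta> - \<alpha>)\<bar> \<le> real_of_int (b - a)" by linarith
    then show ?thesis unfolding s_def using pos by (simp add: abs_divide)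
  qed
  have Dends: "(real_of_int a, 0) \<in> D \<epsilon>" "(real_of_int b, 0) \<in> D \<epsilon>" for \<epsilon>
    using ends unfolding D L ma mb by simp_all
  have axis: "(real_of_int i, 0) \<in> D \<epsilon>" if "a \<le> i" "i \<le> b" for i \<epsilon>
    by (rule convex_horizontal[OF convD Dends]) (use that in auto)
  \<comment> \<open>The spine. \<open>m\<close> is the segment between the two ends, and \<open>D 1\<close>, \<open>D (- 1)\<close> are \<open>Q\<close> in the coordinates with \<open>m\<close> as axis, upright and upside down.\<close>
  have "\<forall>i. \<exists>j. a \<le> i \<and> i \<le> b \<longrightarrow> (i, j) \<in> L \<and> \<bar>real_of_int j - m (real_of_int i)\<bar> < 1"
  proof
    fix i
    show "\<exists>j. a \<le> i \<and> i \<le> b \<longrightarrow> (i, j) \<in> L \<and> \<bar>real_of_int j - m (real_of_int i)\<bar> < 1"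
    proof (cases "a \<le> i \<and> i \<le> b")
      case True
      then have "\<exists>j. (i, j) \<in> L" using cross[of i] ends(2) by (cases "i = b") auto
      then obtain j where "(real_of_int i, real_of_int j) \<in> Q" unfolding L by blast
      moreover have "(real_of_int i, m (real_of_int i)) \<in> Q" using axis[of i 1] True unfolding D by simp
      ultimately show ?thesis using lattice_point_near[OF Q] unfolding L by blast
    next
      case False
      then show ?thesis by blast
    qed
  qed
  from choice[OF this] obtain c where
    "\<forall>i. a \<le> i \<and> i \<le> b \<longrightarrow> (i, c i) \<in> L \<and> \<bar>real_of_int (c i) - m (real_of_int i)\<bar> < 1" ..
  then have c: "(i, c i) \<in> L" "\<bar>real_of_int (c i) - m (real_of_int i)\<bar> < 1" if "a \<le> i" "i \<le> b" for i
    using that by blast+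
  have conv: "(i, l) \<in> L" if "(i, j) \<in> L" "(i, k) \<in> L" "j \<le> l" "l \<le> k" for i j k l
    using that convex_vertical[OF Q, of "real_of_int i" "real_of_int j" "real_of_int k" "real_of_int l"]
    unfolding L by simp
  have cross': "\<exists>k. (i, k) \<in> L \<and> (i + 1, k) \<in> L" if "(i, j) \<in> L" "(i + 1, j') \<in> L" for i j j'
    using cross[of i] width[OF that(1)] width[OF that(2)] by simp
  have c_step: "\<bar>c (i + 1) - c i\<bar> \<le> 2" if "(i, j) \<in> L" "(i + 1, j') \<in> L" for i j j'
  proof -
    have i: "a \<le> i" "i \<le> b" "a \<le> i + 1" "i + 1 \<le> b" using width[OF that(1)] width[OF that(2)] by auto
    have "m (real_of_int (i + 1)) - m (real_of_int i) = s" unfolding m_def by (simp add: algebra_simps)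
    then have "\<bar>real_of_int (c (i + 1)) - real_of_int (c i)\<bar> < 3"
      using c(2)[OF i(1,2)] c(2)[OF i(3,4)] s1 by linarith
    then show ?thesis by linarith
  qed
  \<comment> \<open>Both mountains, in terms of heights above and below the spine.\<close>
  have mem_up: "(real_of_int i, real_of_int y + (real_of_int (c i) - m (real_of_int i))) \<in> D 1
      \<longleftrightarrow> (i, c i + y) \<in> L" for i y
    unfolding D L by (simp add: algebra_simps)
  have mem_down: "(real_of_int i, real_of_int y + (m (real_of_int i) - real_of_int (c i))) \<in> D (- 1)
      \<longleftrightarrow> (i, c i - y) \<in> L" for i y
    unfolding D L by (simp add: algebra_simps)
  let ?M = "{a + (b - a) div 4..a + 3 * (b - a) div 4}"
  define Up where "Up = (\<lambda>i. {y. 0 < y \<and> (i, c i + y) \<in> L})"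
  define Down where "Down = (\<lambda>i. {y. 0 < y \<and> (i, c i - y) \<in> L})"
  define up where "up = (\<lambda>d i. {y. 0 < y \<and> y \<le> d \<and> (real_of_int i, real_of_int y + 1) \<in> D 1})"
  define down where "down = (\<lambda>d i. {y. 0 < y \<and> y \<le> d \<and> (real_of_int i, real_of_int y + 1) \<in> D (- 1)})"
  have "\<exists>d\<ge>0. (\<forall>i\<in>?M. \<forall>y. 0 < y \<and> y \<le> d \<longrightarrow> (real_of_int i, real_of_int y + 1) \<in> D 1)
    \<and> (\<forall>i\<in>{a..b}. card {y. 0 < y \<and> (real_of_int i, real_of_int y + (real_of_int (c i) - m (real_of_int i))) \<in> D 1}
      \<le> 25 * (card {y. 0 < y \<and> y \<le> d \<and> (real_of_int i, real_of_int y + 1) \<in> D 1} + 1))"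
  proof (rule mountain_arm[OF convD Dends ab])
    show "\<bar>real_of_int (c i) - m (real_of_int i)\<bar> \<le> 1" if "a \<le> i" "i \<le> b" for i
      using c(2)[OF that] by simp
    show "y \<le> b - a" if i: "a \<le> i" "i \<le> b"
      and "(real_of_int i, real_of_int y + (real_of_int (c i) - m (real_of_int i))) \<in> D 1" for i y
      using height[OF c(1)[OF i], of i "c i + y"] that(3) unfolding mem_up by simp
  qed
  then obtain d where d: "0 \<le> d" "\<And>i y. i \<in> ?M \<Longrightarrow> 0 < y \<Longrightarrow> y \<le> d \<Longrightarrow> (real_of_int i, real_of_int y + 1) \<in> D 1"
    "\<And>i. i \<in> {a..b} \<Longrightarrow> card (Up i) \<le> 25 * (card (up d i) + 1)"
    unfolding mem_up Up_def up_def by blast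
  have "\<exists>d\<ge>0. (\<forall>i\<in>?M. \<forall>y. 0 < y \<and> y \<le> d \<longrightarrow> (real_of_int i, real_of_int y + 1) \<in> D (- 1))
    \<and> (\<forall>i\<in>{a..b}. card {y. 0 < y \<and> (real_of_int i, real_of_int y + (m (real_of_int i) - real_of_int (c i))) \<in> D (- 1)}
      \<le> 25 * (card {y. 0 < y \<and> y \<le> d \<and> (real_of_int i, real_of_int y + 1) \<in> D (- 1)} + 1))"
  proof (rule mountain_arm[OF convD Dends ab])
    show "\<bar>m (real_of_int i) - real_of_int (c i)\<bar> \<le> 1" if "a \<le> i" "i \<le> b" for i
      using c(2)[OF that] by simp
    show "y \<le> b - a" if i: "a \<le> i" "i \<le> b"
      and "(real_of_int i, real_of_int y + (m (real_of_int i) - real_of_int (c i))) \<in> D (- 1)" for i y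
      using height[of i "c i - y" i "c i"] c(1)[OF i] that(3) unfolding mem_down by simp
  qed
  then obtain e where e: "0 \<le> e" "\<And>i y. i \<in> ?M \<Longrightarrow> 0 < y \<Longrightarrow> y \<le> e \<Longrightarrow> (real_of_int i, real_of_int y + 1) \<in> D (- 1)"
    "\<And>i. i \<in> {a..b} \<Longrightarrow> card (Down i) \<le> 25 * (card (down e i) + 1)"
    unfolding mem_down Down_def down_def by blast
  have up_L: "(i, c i + y) \<in> L" if i: "a \<le> i" "i \<le> b" and y: "0 < y" "(real_of_int i, real_of_int y + 1) \<in> D 1" for i y
    unfolding mem_up[symmetric]
    by (rule convex_vertical[OF convD axis[OF i] y(2)]) (use c(2)[OF i] y(1) in \<open>auto simp: abs_less_iff\<close>)
  have down_L: "(i, c i - y) \<in> L" if i: "a \<le> i" "i \<le> b" and y: "0 < y" "(real_of_int i, real_of_int y + 1) \<in> D (- 1)" for i y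
    unfolding mem_down[symmetric]
    by (rule convex_vertical[OF convD axis[OF i] y(2)]) (use c(2)[OF i] y(1) in \<open>auto simp: abs_less_iff\<close>)
  \<comment> \<open>\<open>A\<close> is cut out by conditions on \<open>D\<close> that are free of rounding errors, so its sheared rows have no gaps; the rows of \<open>L\<close> itself may have some. \<open>R\<close> is the rectangle over the middle columns.\<close>
  define row where "row = (\<lambda>v. snd v - c (fst v))"
  define P where "P = (\<lambda>i y. y = 0 \<or> y \<in> up d i \<or> - y \<in> down e i)"
  define A where "A = {v. a \<le> fst v \<and> fst v \<le> b \<and> P (fst v) (row v)}"
  define R where "R = {v. fst v \<in> ?M \<and> row v \<in> {- e..d}}"
  have A_pt: "(i, c i + y) \<in> A \<longleftrightarrow> a \<le> i \<and> i \<le> b \<and> P i y" for i y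
    unfolding A_def row_def by simp
  have R_pt: "(i, c i + y) \<in> R \<longleftrightarrow> i \<in> ?M \<and> y \<in> {- e..d}" for i y
    unfolding R_def row_def by simp
  have pt: "\<exists>i y. v = (i, c i + y) \<and> row v = y" for v
    by (intro exI[of _ "fst v"] exI[of _ "snd v - c (fst v)"]) (simp add: prod_eq_iff row_def)
  have row_pt: "row (i, c i + y) = y" for i y unfolding row_def by simp
  have AL: "A \<subseteq> L"
  proof
    fix v assume v: "v \<in> A"
    obtain i y where vi: "v = (i, c i + y)" using pt by blast
    have i: "a \<le> i" "i \<le> b" and "P i y" using v unfolding vi A_pt by auto
    then show "v \<in> L"
      using c(1)[OF i] up_L[OF i, of y] down_L[OF i, of "- y"] unfolding vi P_def up_def down_def by auto
  qed
  have P_range: "- e \<le> y" "y \<le> d" if "P i y" for i y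
    using that d(1) e(1) unfolding P_def up_def down_def by auto
  have M_ab: "a \<le> i" "i \<le> b" if "i \<in> ?M" for i
  proof -
    define z z' where "z = 3 * (b - a) div 4" and "z' = (b - a) div 4"
    have "4 * z \<le> 3 * b - 3 * a" "0 \<le> z'" unfolding z_def z'_def using ab by presburger+
    moreover have "i \<le> a + z" "a + z' \<le> i" using that unfolding z_def z'_def by auto
    ultimately show "a \<le> i" "i \<le> b" using ab by auto
  qed
  have M_card: "N \<le> 2 * card ?M"
  proof -
    have "b - a + 1 \<le> 2 * (3 * (b - a) div 4 - (b - a) div 4 + 1)" using ab by presburger
    then show ?thesis using intN by simp
  qed
  have RA: "R \<subseteq> A"
  proof
    fix v assume v: "v \<in> R"
    obtain i y where vi: "v = (i, c i + y)" using pt by blast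
    have i: "i \<in> ?M" and y: "- e \<le> y" "y \<le> d" using v unfolding vi R_pt by auto
    have "P i y" using d(2)[OF i, of y] e(2)[OF i, of "- y"] y unfolding P_def up_def down_def by force
    then show "v \<in> A" unfolding vi A_pt using M_ab[OF i] by simp
  qed
  have finL: "finite L"
  proof (rule finite_subset)
    show "L \<subseteq> {a..b} \<times> {\<alpha> - (b - a)..\<alpha> + (b - a)}"
    proof
      fix v assume v: "v \<in> L"
      obtain i j where ij: "v = (i, j)" by (cases v)
      show "v \<in> {a..b} \<times> {\<alpha> - (b - a)..\<alpha> + (b - a)}"
        using width[of i j] height[OF ends(1), of i j] height[OF _ ends(1), of i j] v unfolding ij by auto
    qed
  qed simp
  have finA: "finite A" using AL finL finite_subset by blast
  \<comment> \<open>From \<open>R\<close> to \<open>A\<close> along rows, as the middle columns are half of all, and from \<open>A\<close> to \<open>L\<close> along columns.\<close>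
  have cols: "fibre_routable (lattice_edges L) L fst (72 * N)"
  proof (rule fibre_routable_mono[OF columns_routable[where L = L and N = N, OF conv] subset_refl])
    show "k - j < int N" if "(i, j) \<in> L" "(i, k) \<in> L" for i j k
      using height[OF that] intN by simp
  qed simp_all
  have rows: "fibre_routable (lattice_edges L) A row (72 * N)"
    unfolding row_def
  proof (rule sheared_rows_routable[where L = L and c = c and A = A and N = N, OF conv cross' c_step AL])
    fix i j k y assume "(i, c i + y) \<in> A" "(k, c k + y) \<in> A" and ijk: "i \<le> j" "j \<le> k"
    then have ik: "a \<le> i" "k \<le> b" "P i y" "P k y" unfolding A_pt by auto
    have "P j y"
    proof -
      consider "y = 0" | "0 < y" | "y < 0" by linarith
      then show ?thesis
      proof cases
        case 2
        have "(real_of_int j, real_of_int y + 1) \<in> D 1"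
          by (rule convex_horizontal[OF convD, of "real_of_int i" _ _ "real_of_int k"])
            (use ik(3,4) 2 ijk in \<open>auto simp: P_def up_def down_def\<close>)
        then show ?thesis using 2 ik(3) unfolding P_def up_def down_def by auto
      next
        case 3
        have "(real_of_int j, real_of_int (- y) + 1) \<in> D (- 1)"
          by (rule convex_horizontal[OF convD, of "real_of_int i" _ _ "real_of_int k"])
            (use ik(3,4) 3 ijk in \<open>auto simp: P_def up_def down_def\<close>)
        then show ?thesis using 3 ik(3) unfolding P_def up_def down_def by auto
      qed (simp add: P_def)
    qed
    then show "(j, c j + y) \<in> A" unfolding A_pt using ik ijk by simp
  next
    fix v w assume "v \<in> A" "w \<in> A"
    then show "fst w - fst v < int N" unfolding A_def intN by auto
  qed
  have "bij_betw (\<lambda>v. (fst v, row v)) R (?M \<times> {- e..d})"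
    unfolding bij_betw_def
  proof
    show "inj_on (\<lambda>v. (fst v, row v)) R" by (rule inj_onI) (auto simp: row_def prod_eq_iff)
    show "(\<lambda>v. (fst v, row v)) ` R = ?M \<times> {- e..d}"
    proof (intro equalityI subsetI)
      fix w assume w: "w \<in> ?M \<times> {- e..d}"
      obtain i y where iy: "w = (i, y)" by (cases w)
      have "(i, c i + y) \<in> R" using w unfolding iy R_pt by auto
      then show "w \<in> (\<lambda>v. (fst v, row v)) ` R"
        unfolding iy by (rule image_eqI[rotated]) (simp add: row_pt)
    qed (auto simp: R_def)
  qed
  then have "routable (lattice_edges L) R (3 * (72 * N))"
    by (rule routable_rectangle[rotated 2])
      (use fibre_routable_mono[OF cols _ order_refl] fibre_routable_mono[OF rows RA order_refl] RA AL in auto)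
  then have "routable (lattice_edges L) A (3 ^ 1 * (3 * (72 * N) + 2 * (72 * N)))"
  proof (rule routable_fill[OF finA rows RA])
    fix y
    show "card {v \<in> A. row v = y} \<le> 2 ^ 1 * card {v \<in> R. row v = y}"
    proof (cases "- e \<le> y \<and> y \<le> d")
      case False
      then have none: "{v \<in> A. row v = y} = {}" using P_range unfolding A_def by blast
      show ?thesis unfolding none by simp
    next
      case True
      have "card {v \<in> A. row v = y} \<le> card {a..b}"
        by (rule card_inj_on_le[where f = fst]) (auto simp: inj_on_def prod_eq_iff row_def A_def)
      also have "\<dots> = N" unfolding N_def by simp
      also have "\<dots> \<le> 2 * card ?M" by (rule M_card)
      also have "card ?M \<le> card {v \<in> R. row v = y}"
      proof (rule card_inj_on_le[where f = "\<lambda>i. (i, c i + y)"])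
        show "finite {v \<in> R. row v = y}" using finA RA finite_subset by (metis (no_types, lifting) mem_Collect_eq subset_iff)
      qed (use True R_pt row_pt in \<open>auto simp: inj_on_def\<close>)
      finally show ?thesis by simp
    qed
  qed
  then have "routable (lattice_edges L) L (3 ^ 6 * (3 ^ 1 * (3 * (72 * N) + 2 * (72 * N)) + 2 * (72 * N)))"
  proof (rule routable_fill[OF finL cols AL])
    fix i
    show "card {v \<in> L. fst v = i} \<le> 2 ^ 6 * card {v \<in> A. fst v = i}"
    proof (cases "a \<le> i \<and> i \<le> b")
      case False
      then have none: "{v \<in> L. fst v = i} = {}" using width by fastforce
      show ?thesis unfolding none by simp
    next
      case True
      then have i: "a \<le> i" "i \<le> b" by auto
      have fin_up: "finite (up d i)" unfolding up_def by (rule finite_subset[of _ "{0<..d}"]) auto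
      have fin_down: "finite (down e i)" unfolding down_def by (rule finite_subset[of _ "{0<..e}"]) auto
      have finUp: "finite (Up i)"
        by (rule finite_subset[of _ "{0<..b - a}"]) (use height[OF c(1)[OF i]] in \<open>force simp: Up_def\<close>)+
      have finDown: "finite (Down i)"
        by (rule finite_subset[of _ "{0<..b - a}"]) (use height[OF _ c(1)[OF i]] in \<open>force simp: Down_def\<close>)+
      let ?pt = "\<lambda>y. (i, c i + y)"
      have "{v \<in> L. fst v = i} \<subseteq> ?pt ` ({0} \<union> (Up i \<union> uminus ` Down i))"
      proof
        fix v assume v: "v \<in> {v \<in> L. fst v = i}"
        obtain i' y where v': "v = (i', c i' + y)" using pt by blast
        have y: "v = ?pt y" using v unfolding v' by auto
        have "y = 0 \<or> y \<in> Up i \<or> - y \<in> Down i" using v unfolding y Up_def Down_def by auto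
        then have "y \<in> {0} \<union> (Up i \<union> uminus ` Down i)" using image_eqI[of y uminus "- y"] by auto
        then show "v \<in> ?pt ` ({0} \<union> (Up i \<union> uminus ` Down i))" unfolding y by blast
      qed
      then have "card {v \<in> L. fst v = i} \<le> card (?pt ` ({0} \<union> (Up i \<union> uminus ` Down i)))"
        using finUp finDown by (intro card_mono) auto
      also have "\<dots> \<le> card ({0} \<union> (Up i \<union> uminus ` Down i))"
        using finUp finDown by (intro card_image_le) auto
      also have "\<dots> \<le> card {0::int} + (card (Up i) + card (uminus ` Down i))"
        by (intro order_trans[OF card_Un_le] add_left_mono card_Un_le)
      also have "\<dots> \<le> 1 + (card (Up i) + card (Down i))"
        using card_image_le[OF finDown, of uminus] by simp
      also have "\<dots> \<le> 1 + (25 * (card (up d i) + 1) + 25 * (card (down e i) + 1))"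
        using d(3)[of i] e(3)[of i] i by (intro add_mono) auto
      also have "\<dots> \<le> 2 ^ 6 * (1 + (card (up d i) + card (down e i)))" by simp
      also have "1 + (card (up d i) + card (down e i)) \<le> card {v \<in> A. fst v = i}"
      proof -
        have "card (uminus ` down e i) = card (down e i)" by (intro card_image) auto
        moreover have "card (up d i \<union> uminus ` down e i) = card (up d i) + card (uminus ` down e i)"
          by (rule card_Un_disjoint) (use fin_up fin_down in \<open>auto simp: up_def down_def\<close>)
        moreover have "card ({0} \<union> (up d i \<union> uminus ` down e i)) = card {0::int} + card (up d i \<union> uminus ` down e i)"
          by (rule card_Un_disjoint) (use fin_up fin_down in \<open>auto simp: up_def down_def\<close>)
        moreover have "card ({0} \<union> (up d i \<union> uminus ` down e i)) \<le> card {v \<in> A. fst v = i}"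
        proof (rule card_inj_on_le[where f = ?pt])
          show "?pt ` ({0} \<union> (up d i \<union> uminus ` down e i)) \<subseteq> {v \<in> A. fst v = i}"
          proof
            fix v assume "v \<in> ?pt ` ({0} \<union> (up d i \<union> uminus ` down e i))"
            then obtain y where "v = ?pt y" "P i y" unfolding P_def by auto
            then show "v \<in> {v \<in> A. fst v = i}" using A_pt i by simp
          qed
          show "finite {v \<in> A. fst v = i}" using finA by simp
        qed (auto simp: inj_on_def)
        ultimately show ?thesis by simp
      qed
      finally show ?thesis by simp
    qed
  qed
  then show ?thesis unfolding N_def[symmetric] by (simp add: mult.assoc)
qed

section \<open>Convex grid pieces\<close>

lemma int_sum_squares_eq_1: "(x::int)\<^sup>2 + y\<^sup>2 = 1 \<longleftrightarrow> \<bar>x\<bar> + \<bar>y\<bar> = 1"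
proof
  assume eq: "x\<^sup>2 + y\<^sup>2 = 1"
  have "x\<^sup>2 \<le> 1" "y\<^sup>2 \<le> 1" using eq zero_le_power2[of x] zero_le_power2[of y] by linarith+
  then have "\<bar>x\<bar> \<le> 1" "\<bar>y\<bar> \<le> 1" by (simp_all only: abs_square_le_1)
  then have "x \<in> {-1, 0, 1}" "y \<in> {-1, 0, 1}" by auto
  then show "\<bar>x\<bar> + \<bar>y\<bar> = 1" using eq by auto
next
  assume "\<bar>x\<bar> + \<bar>y\<bar> = 1"
  then have "x = 0 \<and> \<bar>y\<bar> = 1 \<or> \<bar>x\<bar> = 1 \<and> y = 0" by linarith
  then show "x\<^sup>2 + y\<^sup>2 = 1" by (metis add.commute add_0 one_power2 power2_abs zero_power2)
qed

lemma dist_lattice_eq_1: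
  "dist (real_of_int i, real_of_int j) (real_of_int k, real_of_int l) = 1 \<longleftrightarrow> \<bar>i - k\<bar> + \<bar>j - l\<bar> = 1"
proof -
  have "dist (real_of_int i, real_of_int j) (real_of_int k, real_of_int l) = 1
      \<longleftrightarrow> real_of_int ((i - k)\<^sup>2 + (j - l)\<^sup>2) = real_of_int 1"
    by (simp add: dist_Pair_Pair dist_real_def)
  then show ?thesis unfolding of_int_eq_iff int_sum_squares_eq_1 .
qed

text \<open>
  \<open>e\<close> embeds the lattice into the plane, either directly or with exchanged coordinates, so that the wider direction of
  \<open>P\<close> can be taken as the horizontal one. Connectedness is used in one place: a path from a leftmost to a rightmost vertex
  crosses between any two consecutive columns along an edge, so these columns have a common row.
\<close>

lemma rt_le_extent:
  fixes P Q :: "(real \<times> real) set" and L :: "(int \<times> int) set" and e :: "int \<times> int \<Rightarrow> real \<times> real"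
  assumes Q: "convex Q" and L: "\<And>i j. (i, j) \<in> L \<longleftrightarrow> (real_of_int i, real_of_int j) \<in> Q"
    and fin: "finite L" and e: "inj e" "grid_vertices P = e ` L"
    and unit: "\<And>u v. dist (e u) (e v) = 1 \<longleftrightarrow> \<bar>fst u - fst v\<bar> + \<bar>snd u - snd v\<bar> = 1"
    and conn: "graph_connected (grid_vertices P) (grid_edges P)"
    and u: "u \<in> L" "\<And>v. v \<in> L \<Longrightarrow> fst u \<le> fst v" and w: "w \<in> L" "\<And>v. v \<in> L \<Longrightarrow> fst v \<le> fst w"
    and height: "\<And>v v'. v \<in> L \<Longrightarrow> v' \<in> L \<Longrightarrow> snd v' - snd v \<le> fst w - fst u"
  shows "rt P \<le> 2 * (3 ^ 6 * 17 * 72) * nat (fst w - fst u)"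
proof -
  define K :: nat where "K = 3 ^ 6 * 17 * 72"
  have "routable (grid_edges P) (e ` L) (2 * K * nat (fst w - fst u))"
  proof (cases "fst u < fst w")
    case True
    have cross: "\<exists>k. (i, k) \<in> L \<and> (i + 1, k) \<in> L" if i: "fst u \<le> i" "i < fst w" for i
    proof (rule ccontr)
      assume none: "\<not> (\<exists>k. (i, k) \<in> L \<and> (i + 1, k) \<in> L)"
      have "\<exists>v\<in>L. z = e v \<and> fst v \<le> i" if "(\<lambda>a b. {a, b} \<in> grid_edges P)\<^sup>*\<^sup>* (e u) z" for z
        using that
      proof (induction rule: rtranclp_induct)
        case base
        show ?case using u(1) i(1) by blast
      next
        case (step y z)
        then obtain v where v: "v \<in> L" "y = e v" "fst v \<le> i" by blast
        have "z \<in> grid_vertices P" "dist y z = 1"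
          using step.hyps(2) unfolding grid_edges_def by (auto simp: doubleton_eq_iff dist_commute)
        then obtain v' where v': "v' \<in> L" "z = e v'" "dist (e v) (e v') = 1"
          unfolding e(2) v(2) by blast
        have adj: "\<bar>fst v - fst v'\<bar> + \<bar>snd v - snd v'\<bar> = 1" using v'(3) unfolding unit .
        have "fst v' \<le> i"
        proof (rule ccontr)
          assume "\<not> fst v' \<le> i"
          then have "fst v = i" "fst v' = i + 1" "snd v = snd v'" using adj v(3) by linarith+
          then have "(i, snd v) \<in> L" "(i + 1, snd v) \<in> L" using v(1) v'(1) by (metis prod.collapse)+
          then show False using none by blast
        qed
        then show ?case using v' by blast
      qed
      then obtain v where "v \<in> L" "e w = e v" "fst v \<le> i"
        using conn u(1) w(1) unfolding graph_connected_def e(2) by blast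
      then show False using i(2) injD[OF e(1)] by fastforce
    qed
    have "routable (lattice_edges L) L (K * nat (fst w - fst u + 1))"
      unfolding K_def
    proof (rule lattice_routable[OF Q L _ _ True])
      show "(fst u, snd u) \<in> L" "(fst w, snd w) \<in> L" using u(1) w(1) by simp_all
      show "fst u \<le> i \<and> i \<le> fst w" if "(i, j) \<in> L" for i j using u(2)[OF that] w(2)[OF that] by simp
      show "l - j \<le> fst w - fst u" if "(i, j) \<in> L" "(k, l) \<in> L" for i j k l
        using height[OF that] by simp
    qed (fact cross)
    then have "routable (grid_edges P) (e ` L) (K * nat (fst w - fst u + 1))"
    proof (rule routable_transport)
      show "inj_on e L" using e(1) inj_on_subset by blast
      fix X assume "X \<in> lattice_edges L"
      then obtain v v' where v: "X = {v, v'}" "v \<in> L" "v' \<in> L" "\<bar>fst v - fst v'\<bar> + \<bar>snd v - snd v'\<bar> = 1"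
        unfolding lattice_edges_def by blast
      show "X \<subseteq> L" using v by simp
      have "e ` X = {e v, e v'}" unfolding v(1) by simp
      then show "e ` X \<in> grid_edges P"
        unfolding grid_edges_def e(2) using v(2,3) v(4)[folded unit] by blast
    qed
    moreover have "K * nat (fst w - fst u + 1) \<le> 2 * K * nat (fst w - fst u)"
    proof -
      have "nat (fst w - fst u + 1) \<le> 2 * nat (fst w - fst u)" using True by simp
      then have "K * nat (fst w - fst u + 1) \<le> K * (2 * nat (fst w - fst u))" by (rule mult_le_mono2)
      then show ?thesis by (simp add: mult.assoc mult.left_commute)
    qed
    ultimately show ?thesis unfolding routable_def by (blast intro: realizable_mono)
  next
    case False
    have "v = u" if v: "v \<in> L" for v
      using u(2)[OF v] w(2)[OF v] height[OF v u(1)] height[OF u(1) v] False by (simp add: prod_eq_iff)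
    then have single: "e ` L = {e u}" using u(1) by blast
    have "realizable (grid_edges P) k p" if "p permutes {e u}" for p k
      using that realizable_id[of "grid_edges P" k] by (simp only: permutes_sing)
    then show ?thesis unfolding routable_def single by blast
  qed
  then show ?thesis
    unfolding rt_def e(2) K_def using routing_number_le[of "e ` L" "grid_edges P"] fin by simp
qed

lemma extent_le_width:
  assumes "bounded P" "p \<in> P" "q \<in> P"
  shows "\<bar>fst p - fst q\<bar> \<le> width P" "\<bar>snd p - snd q\<bar> \<le> height P"
proof -
  obtain B where B: "\<And>x. x \<in> P \<Longrightarrow> norm x \<le> B" using assms(1) unfolding bounded_iff by blast
  have coord: "\<bar>fst x\<bar> \<le> B \<and> \<bar>snd x\<bar> \<le> B" if "x \<in> P" for x
    using B[OF that] norm_fst_le[of "fst x" "snd x"] norm_snd_le[of "snd x" "fst x"] by simp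
  have "\<bar>fst p - fst q\<bar> \<le> 2 * B \<and> \<bar>snd p - snd q\<bar> \<le> 2 * B" if "p \<in> P" "q \<in> P" for p q
    using coord[OF that(1)] coord[OF that(2)] by (simp add: abs_le_iff)
  then have bdd: "bdd_above {\<bar>fst p - fst q\<bar> | p q. p \<in> P \<and> q \<in> P}"
    "bdd_above {\<bar>snd p - snd q\<bar> | p q. p \<in> P \<and> q \<in> P}"
    by (auto intro!: bdd_aboveI[of _ "2 * B"])
  show "\<bar>fst p - fst q\<bar> \<le> width P" unfolding width_def
    by (rule cSup_upper[OF _ bdd(1)]) (use assms in blast)
  show "\<bar>snd p - snd q\<bar> \<le> height P" unfolding height_def
    by (rule cSup_upper[OF _ bdd(2)]) (use assms in blast)
qed

lemma rt_le_width_plus_height: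
  assumes P: "convex_polygon P" and conn: "graph_connected (grid_vertices P) (grid_edges P)"
  shows "real (rt P) \<le> 2 * (3 ^ 6 * 17 * 72) * (width P + height P)"
proof -
  have convP: "convex P" and bddP: "bounded P"
    using P polytope_imp_convex polytope_imp_bounded unfolding convex_polygon_def by auto
  have "P \<noteq> {}" using P unfolding convex_polygon_def by auto
  then obtain p0 where p0: "p0 \<in> P" by blast
  have wh: "0 \<le> width P" "0 \<le> height P" using extent_le_width[OF bddP p0 p0] by simp_all
  define e :: "int \<times> int \<Rightarrow> real \<times> real" where "e = (\<lambda>v. (real_of_int (fst v), real_of_int (snd v)))"
  define L where "L = {v. e v \<in> P}"
  have grid: "grid_vertices P = e ` L"
  proof (intro equalityI subsetI)
    fix x assume "x \<in> grid_vertices P"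
    then obtain i j where "x = (real_of_int i, real_of_int j)" "x \<in> P"
      unfolding grid_vertices_def Ints_def by auto
    then show "x \<in> e ` L" unfolding L_def e_def by (intro image_eqI[of _ _ "(i, j)"]) auto
  qed (auto simp: grid_vertices_def L_def e_def)
  obtain B where B: "\<And>x. x \<in> P \<Longrightarrow> norm x \<le> B" using bddP unfolding bounded_iff by blast
  have "L \<subseteq> {\<lfloor>- B\<rfloor>..\<lceil>B\<rceil>} \<times> {\<lfloor>- B\<rfloor>..\<lceil>B\<rceil>}"
  proof
    fix v assume "v \<in> L"
    then have "norm (e v) \<le> B" using B unfolding L_def by simp
    then have "\<bar>real_of_int (fst v)\<bar> \<le> B" "\<bar>real_of_int (snd v)\<bar> \<le> B"
      using norm_fst_le[of "fst (e v)" "snd (e v)"] norm_snd_le[of "snd (e v)" "fst (e v)"]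
      unfolding e_def by simp_all
    then show "v \<in> {\<lfloor>- B\<rfloor>..\<lceil>B\<rceil>} \<times> {\<lfloor>- B\<rfloor>..\<lceil>B\<rceil>}"
      by (cases v) (simp; linarith)
  qed
  then have finL: "finite L" by (rule finite_subset) simp
  show ?thesis
  proof (cases "L = {}")
    case True
    have "routable (grid_edges P) {} 0" unfolding routable_def by (simp only: permutes_empty realizable.simps) blast
    then have "rt P \<le> 0" unfolding rt_def grid True image_empty by (rule routing_number_le[rotated]) simp
    then show ?thesis using wh by simp
  next
    case False
    have ext: "\<exists>v\<in>L. f v = Min (f ` L)" "\<exists>v\<in>L. f v = Max (f ` L)" for f :: "int \<times> int \<Rightarrow> int"
    proof -
      have "Min (f ` L) \<in> f ` L" "Max (f ` L) \<in> f ` L" using finL False by simp_all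
      then show "\<exists>v\<in>L. f v = Min (f ` L)" "\<exists>v\<in>L. f v = Max (f ` L)" by (metis imageE)+
    qed
    obtain l where l: "l \<in> L" "fst l = Min (fst ` L)" using ext(1) by blast
    obtain r where r: "r \<in> L" "fst r = Max (fst ` L)" using ext(2) by blast
    obtain b where b: "b \<in> L" "snd b = Min (snd ` L)" using ext(1) by blast
    obtain t where t: "t \<in> L" "snd t = Max (snd ` L)" using ext(2) by blast
    have box: "fst l \<le> fst v" "fst v \<le> fst r" "snd b \<le> snd v" "snd v \<le> snd t" if "v \<in> L" for v
      using that finL unfolding l(2) r(2) b(2) t(2) by auto
    show ?thesis
    proof (cases "snd t - snd b \<le> fst r - fst l")
      case True
      have "rt P \<le> 2 * (3 ^ 6 * 17 * 72) * nat (fst r - fst l)"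
      proof (rule rt_le_extent[OF convP _ finL _ grid _ conn l(1) _ r(1)])
        show "(i, j) \<in> L \<longleftrightarrow> (real_of_int i, real_of_int j) \<in> P" for i j
          unfolding L_def e_def by simp
        show "inj e" unfolding e_def by (auto intro!: injI simp: prod_eq_iff)
        show "dist (e u) (e v) = 1 \<longleftrightarrow> \<bar>fst u - fst v\<bar> + \<bar>snd u - snd v\<bar> = 1" for u v
          unfolding e_def by (rule dist_lattice_eq_1)
        show "snd v' - snd v \<le> fst r - fst l" if "v \<in> L" "v' \<in> L" for v v'
          using box[OF that(1)] box[OF that(2)] True by linarith
      qed (use box in auto)
      then have "real (rt P) \<le> real (2 * (3 ^ 6 * 17 * 72) * nat (fst r - fst l))"
        by (rule of_nat_mono)
      also have "\<dots> = 2 * (3 ^ 6 * 17 * 72) * \<bar>fst (e r) - fst (e l)\<bar>"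
        using box(1)[OF r(1)] unfolding e_def by simp
      also have "\<dots> \<le> 2 * (3 ^ 6 * 17 * 72) * (width P + height P)"
        using extent_le_width(1)[OF bddP, of "e r" "e l"] l(1) r(1) wh(2) unfolding L_def
        by (intro mult_left_mono) auto
      finally show ?thesis .
    next
      case False
      have "convex (prod.swap ` P)"
        using convP by (intro convex_linear_image) (auto simp: linear_iff)
      then have "rt P \<le> 2 * (3 ^ 6 * 17 * 72) * nat (fst (prod.swap t) - fst (prod.swap b))"
      proof (rule rt_le_extent[where L = "prod.swap ` L" and e = "e \<circ> prod.swap"])
        show "(i, j) \<in> prod.swap ` L \<longleftrightarrow> (real_of_int i, real_of_int j) \<in> prod.swap ` P" for i j
          unfolding L_def e_def by (simp add: pair_in_swap_image)
        show "inj (e \<circ> prod.swap)" unfolding e_def by (auto intro!: injI simp: prod_eq_iff)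
        show "dist ((e \<circ> prod.swap) u) ((e \<circ> prod.swap) v) = 1 \<longleftrightarrow> \<bar>fst u - fst v\<bar> + \<bar>snd u - snd v\<bar> = 1" for u v
          using dist_lattice_eq_1[of "snd u" "fst u" "snd v" "fst v"] unfolding e_def by (simp add: add.commute)
        show "grid_vertices P = (e \<circ> prod.swap) ` prod.swap ` L"
          unfolding grid by (simp add: image_comp comp_assoc)
        show "prod.swap b \<in> prod.swap ` L" "prod.swap t \<in> prod.swap ` L" using b(1) t(1) by blast+
        show "finite (prod.swap ` L)" using finL by simp
        show "snd v' - snd v \<le> fst (prod.swap t) - fst (prod.swap b)"
          if vv': "v \<in> prod.swap ` L" "v' \<in> prod.swap ` L" for v v'
        proof -
          obtain x x' where x: "x \<in> L" "v = prod.swap x" "x' \<in> L" "v' = prod.swap x'" using vv' by blast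
          show ?thesis using box[OF x(1)] box[OF x(3)] False unfolding x by simp
        qed
      qed (use conn box in auto)
      then have "real (rt P) \<le> real (2 * (3 ^ 6 * 17 * 72) * nat (fst (prod.swap t) - fst (prod.swap b)))"
        by (rule of_nat_mono)
      also have "\<dots> = 2 * (3 ^ 6 * 17 * 72) * \<bar>snd (e t) - snd (e b)\<bar>"
        using box(3)[OF t(1)] unfolding e_def by simp
      also have "\<dots> \<le> 2 * (3 ^ 6 * 17 * 72) * (width P + height P)"
        using extent_le_width(2)[OF bddP, of "e t" "e b"] b(1) t(1) wh(1) unfolding L_def
        by (intro mult_left_mono) auto
      finally show ?thesis .
    qed
  qed
qed

theorem theorem1:
  "\<exists>C::real. \<forall>P :: (real \<times> real) set.
     convex_polygon P \<longrightarrow> graph_connected (grid_vertices P) (grid_edges P) \<longrightarrow>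
     real (rt P) \<le> C * (width P + height P)"
  using rt_le_width_plus_height by blast

end
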